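(* Let $r>0$ be an integer and let $g\in C^{r+1}[0,1]$ satisfy $g^{(j)}(0)=0$ for $j=0,\dots,r$, $g^{(r+1)}(x)\ne0$ for $x\in[0,1]$, and be monotonically increasing with no inflection point in $[0,1]$; put $\sigma(r):=\max_{x\in[0,1]}|g^{(r+1)}(x)|/(r+1)!$ and $\delta(r):=\min_{x\in[0,1]}|g^{(r+1)}(x)|/(r+1)!$. Let $f\in L^1[0,1]$ be continuous on $(0,1]$, let $\Psi:=(f/g')\circ g^{-1}$ on $(0,g(1)]$ and $\Theta(y):=\Psi(g(1)y)$, $y\in(0,1]$. If $\Theta$ is of $\mathrm{Type}(\alpha,\infty,\{0\})$ for some $\alpha\in(-1,1)$, then there exists a positive constant $c$ such that for all $\kappa>1$ and all $n\in\mathbb{N}$ satisfying $$\kappa_{\sigma(r)}^{1/n}\big(\kappa_{\sigma(r)}^{1/n}-1\big)\le (n-1)/e,$$ one has $$\left|\mathcal{I}_\kappa^{\Lambda}[f,g]-\mathcal{Q}_{\kappa,n}^{\Lambda}[f,g]\right|\le c\,(r+1)\,|g(1)|^{-\alpha}\,\sigma(r)\,(\delta(r))^{\alpha-2}\,\kappa^{-2}\,\kappa_{\sigma(r)}^{1/(r+1)}\,(\rho_n(r))^n .$$ Moreover, for $n\in\mathbb{N}$, $$\mathcal{N}\big(\mathcal{Q}_{\kappa,n}^{\Lambda}[f,g]\big)\le\Big\lceil(r+1)\,\kappa_{\sigma(r)}^{r/(n(r+1))}\,\sigma(r)/\delta(r)\Big\rceil\big(2n^2+\lceil1-\alpha\rceil(n^2+n)\big)/2+1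 .$$
   Context: $\mathbb{N}=\{1,2,\dots\}$. "No inflection point in $[0,1]$" means that $g'$ is monotone on $[0,1]$. Type. A real-valued $\phi\in C^{\infty}((0,1])$ is of $\mathrm{Type}(\alpha,\infty,\{0\})$ if there is a constant $c>0$ with $|\phi^{(k)}(x)|\le c\,x^{\alpha-k}$ for all $x\in(0,1]$ and all $k\in\mathbb{N}$. $\kappa_{\sigma(r)}:=\kappa$ if $\sigma(r)\le1$ and $\kappa_{\sigma(r)}:=\kappa\sigma(r)$ if $\sigma(r)>1$; $\lambda_r:=\kappa_{\sigma(r)}^{-1/(r+1)}$; $\Lambda:=[\lambda_r,1]$; $\rho_n(r):=1-\lambda_r^{1/n}$; $\mathcal{I}_\kappa^{\Lambda}[f,g]:=\int_{\lambda_r}^1f(x)e^{\mathrm{i}\kappa g(x)}\,dx$. Basic Filon-type rule. For $[a,b]\subset(0,1]$ and $m\in\mathbb{N}$, choose (arbitrary) nodes $a=t_0<t_1<\dots<t_m=b$ and let $p_m$ be the polynomial of degree at most $m$ with $p_m(g(t_j))=\Psi(g(t_j))$, $j=0,\dots,m$. Put $\mathcal{Q}^{[a,b]}_{\kappa,m}[f,g]:=\int_{g(a)}^{g(b)}p_m(x)e^{\mathrm{i}\kappa x}\,dx$. For $N\in\mathbb{N}$ let $y_j:=a+(b-a)j/N$, $j=0,\dots,N$, and $\mathcal{Q}^{[a,b]}_{N,\kappa,m}[f,g]:=\sum_{j=1}^{N}\mathcal{Q}^{[y_{j-1},y_j]}_{\kappa,m}[f,g]$. Composite rule on $\Lambda$.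 Let $x_j:=\kappa_{\sigma(r)}^{(j/n-1)/(r+1)}$, $j=0,\dots,n$; for $j=1,\dots,n$ let $M_j:=\max\{|g'(x_{j-1})|,|g'(x_j)|\}$, $q_j:=M_jx_{j-1}/g(x_{j-1})$, $N_j:=\lceil q_j\rceil$, $m_j:=n+\lceil(n+1-j)(1-\alpha)\rceil$. Then $\mathcal{Q}_{\kappa,n}^{\Lambda}[f,g]:=\sum_{j=1}^n\mathcal{Q}^{[x_{j-1},x_j]}_{N_j,\kappa,m_j}[f,g]$. $\mathcal{N}(F)$ denotes the number of evaluations of $\Psi$ used in the formula $F$ (an evaluation at an endpoint shared by two subintervals is counted once). *)

theory Defs
  imports "HOL-Analysis.Analysis" "HOL-Computational_Algebra.Polynomial"
begin

section \<open>Derivatives on an interval and smoothness classes\<close>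

text \<open>Derivatives are taken within \<open>S\<close>, hence one-sided at endpoints belonging to \<open>S\<close>.\<close>

definition nth_deriv_on :: "real set \<Rightarrow> nat \<Rightarrow> (real \<Rightarrow> real) \<Rightarrow> real \<Rightarrow> real" where
  "nth_deriv_on S k \<phi> = ((\<lambda>h x. vector_derivative h (at x within S)) ^^ k) \<phi>"

definition C_k_on :: "nat \<Rightarrow> real set \<Rightarrow> (real \<Rightarrow> real) \<Rightarrow> bool" where
  "C_k_on k S \<phi> \<longleftrightarrow>
     (\<forall>j<k. nth_deriv_on S j \<phi> differentiable_on S) \<and> continuous_on S (nth_deriv_on S k \<phi>)"

definition C_infinity_on :: "real set \<Rightarrow> (real \<Rightarrow> real) \<Rightarrow> bool" where
  "C_infinity_on S \<phi> \<longleftrightarrow> (\<forall>k. C_k_on k S \<phi>)"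

text \<open>\<open>Type(\<alpha>, \<infinity>, {0})\<close>: the constant does not depend on \<open>k\<close>, and there is no bound for \<open>k = 0\<close>.\<close>

definition type_infinity_zero :: "real \<Rightarrow> (real \<Rightarrow> real) \<Rightarrow> bool" where
  "type_infinity_zero \<alpha> \<phi> \<longleftrightarrow>
     C_infinity_on {0<..1} \<phi> \<and>
     (\<exists>c>0. \<forall>x\<in>{0<..1}. \<forall>k\<ge>1. \<bar>nth_deriv_on {0<..1} k \<phi> x\<bar> \<le> c * x powr (\<alpha> - real k))"

definition no_inflection_point :: "(real \<Rightarrow> real) \<Rightarrow> bool" where
  "no_inflection_point g \<longleftrightarrow>
     mono_on {0..1} (nth_deriv_on {0..1} 1 g) \<or> antimono_on {0..1} (nth_deriv_on {0..1} 1 g)"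

section \<open>Quantities attached to the oscillator\<close>

text \<open>For \<open>g\<close> of class \<open>C^{r+1}\<close> the supremum and the infimum are attained, so they are the maximum
  and the minimum over \<open>[0,1]\<close>.\<close>

definition sigma_osc :: "nat \<Rightarrow> (real \<Rightarrow> real) \<Rightarrow> real" where
  "sigma_osc r g = (SUP x\<in>{0..1}. \<bar>nth_deriv_on {0..1} (r + 1) g x\<bar> / fact (r + 1))"

definition delta_osc :: "nat \<Rightarrow> (real \<Rightarrow> real) \<Rightarrow> real" where
  "delta_osc r g = (INF x\<in>{0..1}. \<bar>nth_deriv_on {0..1} (r + 1) g x\<bar> / fact (r + 1))"

definition kappa_sigma :: "nat \<Rightarrow> (real \<Rightarrow> real) \<Rightarrow> real \<Rightarrow> real" where
  "kappa_sigma r g \<kappa> = (if sigma_osc r g \<le> 1 then \<kappa> else \<kappa> * sigma_osc r g)"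

definition lambda_osc :: "nat \<Rightarrow> (real \<Rightarrow> real) \<Rightarrow> real \<Rightarrow> real" where
  "lambda_osc r g \<kappa> = kappa_sigma r g \<kappa> powr (- 1 / real (r + 1))"

definition rho_osc :: "nat \<Rightarrow> (real \<Rightarrow> real) \<Rightarrow> real \<Rightarrow> nat \<Rightarrow> real" where
  "rho_osc r g \<kappa> n = 1 - lambda_osc r g \<kappa> powr (1 / real n)"

definition Psi :: "(real \<Rightarrow> real) \<Rightarrow> (real \<Rightarrow> real) \<Rightarrow> real \<Rightarrow> real" where
  "Psi f g y = (let x = the_inv_into {0..1} g y in f x / nth_deriv_on {0..1} 1 g x)"

definition Theta :: "(real \<Rightarrow> real) \<Rightarrow> (real \<Rightarrow> real) \<Rightarrow> real \<Rightarrow> real" where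
  "Theta f g y = Psi f g (g 1 * y)"

definition osc_integral ::
  "(real \<Rightarrow> real) \<Rightarrow> (real \<Rightarrow> real) \<Rightarrow> nat \<Rightarrow> real \<Rightarrow> complex" where
  "osc_integral f g r \<kappa> =
     integral {lambda_osc r g \<kappa>..1} (\<lambda>x. of_real (f x) * exp (\<i> * of_real (\<kappa> * g x)))"

section \<open>Filon-type rules\<close>

text \<open>A rule depends on the chosen nodes, so these are explicit arguments: \<open>t k\<close> is the \<open>k\<close>-th node of
  a basic rule, \<open>t i k\<close> that on the \<open>i\<close>-th subinterval of a rule with \<open>N\<close> equal subintervals, and
  \<open>t j i k\<close> that on the \<open>i\<close>-th subinterval of \<open>[x\<^sub>j\<^sub>-\<^sub>1, x\<^sub>j]\<close>. The predicates \<open>*_nodes\<close> say that the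
  nodes are admissible; the sets \<open>*_evals\<close> contain the arguments at which \<open>\<Psi>\<close> is evaluated.\<close>

definition filon_nodes :: "nat \<Rightarrow> real \<Rightarrow> real \<Rightarrow> (nat \<Rightarrow> real) \<Rightarrow> bool" where
  "filon_nodes m a b t \<longleftrightarrow> t 0 = a \<and> t m = b \<and> (\<forall>k<m. t k < t (Suc k))"

definition filon_poly ::
  "(real \<Rightarrow> real) \<Rightarrow> (real \<Rightarrow> real) \<Rightarrow> nat \<Rightarrow> (nat \<Rightarrow> real) \<Rightarrow> real poly" where
  "filon_poly f g m t =
     (THE p. degree p \<le> m \<and> (\<forall>k\<le>m. poly p (g (t k)) = Psi f g (g (t k))))"

definition filon_rule ::
  "(real \<Rightarrow> real) \<Rightarrow> (real \<Rightarrow> real) \<Rightarrow> real \<Rightarrow> nat \<Rightarrow> real \<Rightarrow> real \<Rightarrow> (nat \<Rightarrow> real) \<Rightarrow> complex" where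
  "filon_rule f g \<kappa> m a b t =
     integral {g a..g b}
       (\<lambda>x. of_real (poly (filon_poly f g m t) x) * exp (\<i> * of_real (\<kappa> * x)))"

definition filon_evals :: "(real \<Rightarrow> real) \<Rightarrow> nat \<Rightarrow> (nat \<Rightarrow> real) \<Rightarrow> real set" where
  "filon_evals g m t = (\<lambda>k. g (t k)) ` {0..m}"

definition equi_point :: "real \<Rightarrow> real \<Rightarrow> nat \<Rightarrow> nat \<Rightarrow> real" where
  "equi_point a b N i = a + (b - a) * real i / real N"

definition multi_filon_nodes ::
  "nat \<Rightarrow> nat \<Rightarrow> real \<Rightarrow> real \<Rightarrow> (nat \<Rightarrow> nat \<Rightarrow> real) \<Rightarrow> bool" where
  "multi_filon_nodes N m a b t \<longleftrightarrow>
     (\<forall>i\<in>{1..N}. filon_nodes m (equi_point a b N (i - 1)) (equi_point a b N i) (t i))"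

definition multi_filon_rule ::
  "(real \<Rightarrow> real) \<Rightarrow> (real \<Rightarrow> real) \<Rightarrow> nat \<Rightarrow> real \<Rightarrow> nat \<Rightarrow> real \<Rightarrow> real
    \<Rightarrow> (nat \<Rightarrow> nat \<Rightarrow> real) \<Rightarrow> complex" where
  "multi_filon_rule f g N \<kappa> m a b t =
     (\<Sum>i=1..N. filon_rule f g \<kappa> m (equi_point a b N (i - 1)) (equi_point a b N i) (t i))"

definition multi_filon_evals ::
  "(real \<Rightarrow> real) \<Rightarrow> nat \<Rightarrow> nat \<Rightarrow> (nat \<Rightarrow> nat \<Rightarrow> real) \<Rightarrow> real set" where
  "multi_filon_evals g N m t = (\<Union>i\<in>{1..N}. filon_evals g m (t i))"

section \<open>The composite rule on \<open>[\<lambda>\<^sub>r, 1]\<close>\<close>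

definition mesh_point :: "nat \<Rightarrow> (real \<Rightarrow> real) \<Rightarrow> real \<Rightarrow> nat \<Rightarrow> nat \<Rightarrow> real" where
  "mesh_point r g \<kappa> n j = kappa_sigma r g \<kappa> powr ((real j / real n - 1) / real (r + 1))"

definition mesh_count :: "nat \<Rightarrow> (real \<Rightarrow> real) \<Rightarrow> real \<Rightarrow> nat \<Rightarrow> nat \<Rightarrow> nat" where
  "mesh_count r g \<kappa> n j =
     (let x' = mesh_point r g \<kappa> n (j - 1);
          x = mesh_point r g \<kappa> n j;
          M = max \<bar>nth_deriv_on {0..1} 1 g x'\<bar> \<bar>nth_deriv_on {0..1} 1 g x\<bar>
      in nat \<lceil>M * x' / g x'\<rceil>)"

definition mesh_degree :: "real \<Rightarrow> nat \<Rightarrow> nat \<Rightarrow> nat" where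
  "mesh_degree \<alpha> n j = n + nat \<lceil>(real n + 1 - real j) * (1 - \<alpha>)\<rceil>"

definition composite_nodes ::
  "(real \<Rightarrow> real) \<Rightarrow> nat \<Rightarrow> real \<Rightarrow> real \<Rightarrow> nat \<Rightarrow> (nat \<Rightarrow> nat \<Rightarrow> nat \<Rightarrow> real) \<Rightarrow> bool" where
  "composite_nodes g r \<alpha> \<kappa> n t \<longleftrightarrow>
     (\<forall>j\<in>{1..n}. multi_filon_nodes (mesh_count r g \<kappa> n j) (mesh_degree \<alpha> n j)
                    (mesh_point r g \<kappa> n (j - 1)) (mesh_point r g \<kappa> n j) (t j))"

definition composite_rule ::
  "(real \<Rightarrow> real) \<Rightarrow> (real \<Rightarrow> real) \<Rightarrow> nat \<Rightarrow> real \<Rightarrow> real \<Rightarrow> nat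
    \<Rightarrow> (nat \<Rightarrow> nat \<Rightarrow> nat \<Rightarrow> real) \<Rightarrow> complex" where
  "composite_rule f g r \<alpha> \<kappa> n t =
     (\<Sum>j=1..n. multi_filon_rule f g (mesh_count r g \<kappa> n j) \<kappa> (mesh_degree \<alpha> n j)
                  (mesh_point r g \<kappa> n (j - 1)) (mesh_point r g \<kappa> n j) (t j))"

definition composite_evals ::
  "(real \<Rightarrow> real) \<Rightarrow> nat \<Rightarrow> real \<Rightarrow> real \<Rightarrow> nat \<Rightarrow> (nat \<Rightarrow> nat \<Rightarrow> nat \<Rightarrow> real) \<Rightarrow> real set" where
  "composite_evals g r \<alpha> \<kappa> n t =
     (\<Union>j\<in>{1..n}. multi_filon_evals g (mesh_count r g \<kappa> n j) (mesh_degree \<alpha> n j) (t j))"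

text \<open>The nodes within one subinterval are distinct and \<open>g\<close> is injective, so distinct evaluations have
  distinct arguments, except at endpoints shared by neighbouring subintervals, which count once.\<close>

definition num_evaluations ::
  "(real \<Rightarrow> real) \<Rightarrow> nat \<Rightarrow> real \<Rightarrow> real \<Rightarrow> nat \<Rightarrow> (nat \<Rightarrow> nat \<Rightarrow> nat \<Rightarrow> real) \<Rightarrow> nat" where
  "num_evaluations g r \<alpha> \<kappa> n t = card (composite_evals g r \<alpha> \<kappa> n t)"

end

theory Submission
  imports Defs
begin

text \<open>
  Substituting \<open>y = g x\<close> turns the error of a basic rule into the integral of
  \<open>(\<Psi> - p) exp (\<i> \<kappa> y)\<close>. Since \<open>\<Psi> - p\<close> vanishes at both endpoints, two integrations by parts
  give a factor \<open>\<kappa>\<^sup>-\<^sup>2\<close>, and by Rolle the first two derivatives of \<open>\<Psi> - p\<close> still have \<open>m\<close> and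
  \<open>m - 1\<close> zeros, so the error on an interval of \<open>y\<close>-length \<open>H\<close> is at most
  \<open>(m + 2) / m! H^m max |\<Psi>\<^sup>(\<^sup>m\<^sup>+\<^sup>1\<^sup>)| / \<kappa>^2\<close>. Put \<open>K = \<kappa>\<^sub>\<sigma>\<close>, \<open>\<mu> = K^(1 / (n (r + 1)))\<close> and \<open>\<nu> = \<mu>^(r + 1)\<close>.
  The number of pieces of \<open>[x\<^sub>j\<^sub>-\<^sub>1, x\<^sub>j]\<close> is chosen so that \<open>H \<le> (\<mu> - 1) g(x\<^sub>j\<^sub>-\<^sub>1)\<close>; with the Type bound
  on \<open>\<Psi>\<close> a piece contributes \<open>(m + 2) / m! (\<mu> - 1)^m g(x\<^sub>j\<^sub>-\<^sub>1)^(\<alpha> - 1)\<close>, where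
  \<open>g(x\<^sub>j\<^sub>-\<^sub>1)^(\<alpha> - 1) \<le> \<delta>^(\<alpha> - 1) \<nu>^((n + 1 - j) (1 - \<alpha>))\<close>. The excess of \<open>m\<^sub>j\<close> over \<open>n\<close> absorbs this power of
  \<open>\<nu>\<close> because \<open>\<nu> (\<nu> - 1) \<le> (n - 1) / e\<close>, and what remains is a bounded multiple of
  \<open>(\<mu> - 1)^n = K^(1 / (r + 1)) \<rho>\<^sub>n^n\<close>.
\<close>

section \<open>Interpolation error\<close>

text \<open>Rolle's theorem between consecutive zeros. The points found lie in disjoint open gaps,
  hence are distinct. Subtraction truncates in \<open>card Z - 1\<close>, so an empty
  \<open>Z\<close> is covered.\<close>

lemma rolle_zeros:
  fixes f f' :: "real \<Rightarrow> real"
  assumes deriv: "\<And>x. x \<in> {a..b} \<Longrightarrow> (f has_real_derivative f' x) (at x within {a..b})"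
    and Z: "finite Z" "Z \<subseteq> {a..b}" "\<And>z. z \<in> Z \<Longrightarrow> f z = 0"
  obtains Z' where "finite Z'" "Z' \<subseteq> {a..b}" "card Z' = card Z - 1" "\<And>z. z \<in> Z' \<Longrightarrow> f' z = 0"
proof -
  define u where "u = nth (sorted_list_of_set Z)"
  define j where "j = card Z - 1"
  have len: "length (sorted_list_of_set Z) = card Z" by simp
  have u_less: "u i < u k" if "i < k" "k < card Z" for i k
    using sorted_wrt_nth_less[OF strict_sorted_list_of_set[of Z] that(1)] that len by (simp add: u_def)
  have u_mem: "u i \<in> Z" if "i < card Z" for i
    unfolding u_def using nth_mem[of i "sorted_list_of_set Z"] that len Z(1) by simp
  have "\<exists>s. u i < s \<and> s < u (Suc i) \<and> f' s = 0" if "i < j" for i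
  proof -
    have lt: "u i < u (Suc i)" and mem: "u i \<in> Z" "u (Suc i) \<in> Z"
      using u_less[of i "Suc i"] u_mem[of i] u_mem[of "Suc i"] that by (auto simp: j_def)
    have sub: "{u i..u (Suc i)} \<subseteq> {a..b}" using mem Z(2) by force
    \<comment> \<open>Points strictly between two zeros are interior to \<open>{a..b}\<close>, so
      the derivative within the interval is the two-sided one that Rolle's theorem asks for.\<close>
    have d: "(f has_real_derivative f' x) (at x)" if "u i < x" "x < u (Suc i)" for x
    proof -
      have "a < x" "x < b" using sub that by force+
      then show ?thesis
        using deriv[of x] by (simp add: at_within_Icc_at)
    qed
    have "continuous_on {u i..u (Suc i)} f"
      using DERIV_continuous_on[OF deriv] continuous_on_subset sub by blast
    then obtain z where z: "u i < z" "z < u (Suc i)" "DERIV f z :> 0"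
      using Rolle[OF lt, of f] mem Z(3) d by (metis real_differentiable_def)
    then have "f' z = 0" using d DERIV_unique by blast
    then show ?thesis using z by blast
  qed
  then obtain s where s: "\<And>i. i < j \<Longrightarrow> u i < s i \<and> s i < u (Suc i) \<and> f' (s i) = 0" by metis
  have s_less: "s i < s k" if "i < k" "k < j" for i k
  proof -
    have "s i < u (Suc i)" using s that by simp
    also have "u (Suc i) \<le> u k"
    proof (cases "Suc i = k")
      case False
      then have "Suc i < k" "k < card Z" using that by (auto simp: j_def)
      then show ?thesis using u_less less_imp_le by blast
    qed simp
    also have "u k < s k" using s that by simp
    finally show ?thesis .
  qed
  have inj: "inj_on s {..<j}"
    by (rule linorder_inj_onI') (use s_less in fastforce)
  show thesis
  proof
    show "finite (s ` {..<j})" by simp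
    show "card (s ` {..<j}) = card Z - 1" using card_image[OF inj] by (simp add: j_def)
    show "f' z = 0" if "z \<in> s ` {..<j}" for z using s that by auto
    have "s i \<in> {a..b}" if "i < j" for i
      using s[OF that] u_mem[of i] u_mem[of "Suc i"] Z(2) that by (force simp: j_def)
    then show "s ` {..<j} \<subseteq> {a..b}" by auto
  qed
qed

text \<open>One zero is lost with each differentiation. The derivatives are passed as a sequence
  \<open>F\<close>, so the inductive step is a shift of the index.\<close>

lemma generalized_rolle:
  fixes F :: "nat \<Rightarrow> real \<Rightarrow> real"
  assumes "\<And>k x. k < j \<Longrightarrow> x \<in> {a..b} \<Longrightarrow> (F k has_real_derivative F (Suc k) x) (at x within {a..b})"
    and "finite Z" "Z \<subseteq> {a..b}" "card Z = Suc j" "\<And>z. z \<in> Z \<Longrightarrow> F 0 z = 0"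
  shows "\<exists>x\<in>{a..b}. F j x = 0"
  using assms
proof (induction j arbitrary: F Z)
  case 0
  then show ?case by (metis card_eq_SucD insertI1 subsetD)
next
  case (Suc j)
  obtain Z' where "finite Z'" "Z' \<subseteq> {a..b}" "card Z' = card Z - 1" "\<And>z. z \<in> Z' \<Longrightarrow> F (Suc 0) z = 0"
    using rolle_zeros[of a b "F 0" "F (Suc 0)" Z] Suc.prems by (metis zero_less_Suc)
  then show ?case
    using Suc.IH[of "\<lambda>k. F (Suc k)" Z'] Suc.prems by simp
qed

lemma higher_pderiv_monic:
  fixes p :: "'a::{comm_ring_1,semiring_char_0,semiring_no_zero_divisors} poly"
  assumes "degree p = n" "lead_coeff p = 1"
  shows "(pderiv ^^ n) p = [:fact n:]"
proof (rule poly_eqI)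
  fix k
  show "coeff ((pderiv ^^ n) p) k = coeff [:fact n:] k"
    using assms by (cases k) (auto simp: coeff_higher_pderiv pochhammer_fact coeff_eq_0)
qed

lemma higher_pderiv_eq_0:
  fixes p :: "'a::{comm_ring_1,semiring_char_0,semiring_no_zero_divisors} poly"
  assumes "degree p < n"
  shows "(pderiv ^^ n) p = 0"
  by (rule poly_eqI) (use assms in \<open>auto simp: coeff_higher_pderiv coeff_eq_0\<close>)

text \<open>Cauchy's interpolation remainder, for a function that already vanishes on the nodes. It
  will be applied to derivatives of the error, whose zeros come from Rolle's theorem.\<close>

lemma interpolation_error_bound:
  fixes F :: "nat \<Rightarrow> real \<Rightarrow> real"
  assumes deriv: "\<And>k x. k < j \<Longrightarrow> x \<in> {a..b} \<Longrightarrow> (F k has_real_derivative F (Suc k) x) (at x within {a..b})"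
    and Z: "finite Z" "Z \<subseteq> {a..b}" "card Z = j" "\<And>z. z \<in> Z \<Longrightarrow> F 0 z = 0"
    and bound: "\<And>y. y \<in> {a..b} \<Longrightarrow> \<bar>F j y\<bar> \<le> S"
    and x: "x \<in> {a..b}"
  shows "\<bar>F 0 x\<bar> \<le> S * (b - a) ^ j / fact j"
proof (cases "x \<in> Z")
  case True
  then show ?thesis using Z(4) x bound[OF x] by auto
next
  case False
  define w where "w = (\<Prod>z\<in>Z. [:-z, 1:])"
  \<comment> \<open>This factor makes \<open>F 0 - c w\<close> vanish at \<open>x\<close> too, which
    gives the \<open>Suc j\<close> zeros needed for a zero of its \<open>j\<close>-th
    derivative.\<close>
  define c where "c = F 0 x / poly w x"
  have pw: "poly w y = (\<Prod>z\<in>Z. y - z)" for y by (simp add: w_def poly_prod)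
  have wx: "poly w x \<noteq> 0" using False Z(1) by (auto simp: pw)
  have dw: "degree w = j"
    unfolding w_def by (subst degree_prod_sum_eq) (use Z(3) in auto)
  have lw: "lead_coeff w = 1"
    unfolding w_def by (simp add: lead_coeff_prod)
  define G where "G = (\<lambda>k y. F k y - c * poly ((pderiv ^^ k) w) y)"
  have "\<exists>y\<in>{a..b}. G j y = 0"
  proof (rule generalized_rolle[where Z = "insert x Z" and F = G])
    show "(G k has_real_derivative G (Suc k) y) (at y within {a..b})" if "k < j" "y \<in> {a..b}" for k y
      unfolding G_def by (auto intro!: derivative_eq_intros deriv that poly_DERIV[THEN DERIV_subset])
    show "card (insert x Z) = Suc j" using False Z by simp
    show "G 0 z = 0" if "z \<in> insert x Z" for z
      using that Z(4) Z(1) wx by (auto simp: G_def c_def pw)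
  qed (use Z x in auto)
  \<comment> \<open>The node polynomial \<open>w\<close> is monic of degree \<open>j\<close>, so its
    \<open>j\<close>-th derivative is the constant \<open>fact j\<close>.\<close>
  then obtain y where y: "y \<in> {a..b}" "F j y = c * fact j"
    by (auto simp: G_def higher_pderiv_monic[OF dw lw])
  have "\<bar>poly w x\<bar> \<le> (b - a) ^ j"
  proof -
    have "\<bar>poly w x\<bar> = (\<Prod>z\<in>Z. \<bar>x - z\<bar>)" by (simp add: pw abs_prod)
    also have "\<dots> \<le> (\<Prod>z\<in>Z. b - a)"
      by (rule prod_mono) (use Z(2) x in force)
    finally show ?thesis using Z(3) by simp
  qed
  moreover have "F 0 x = poly w x * F j y / fact j"
    using y wx by (simp add: c_def)
  ultimately have "\<bar>F 0 x\<bar> \<le> (b - a) ^ j * S / fact j"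
    using bound[OF y(1)] x by (auto simp: abs_mult intro!: divide_right_mono mult_mono)
  then show ?thesis by (simp add: mult.commute)
qed

text \<open>Newton's construction: a new node changes the interpolant by a multiple of the node
  polynomial of the old nodes.\<close>

lemma interpolating_poly_exists:
  fixes f :: "'a::field \<Rightarrow> 'a"
  assumes "finite Z" "card Z = Suc m"
  shows "\<exists>p. degree p \<le> m \<and> (\<forall>z\<in>Z. poly p z = f z)"
  using assms
proof (induction m arbitrary: Z)
  case 0
  then obtain z where "Z = {z}" by (metis One_nat_def card_1_singletonE)
  then show ?case by (intro exI[of _ "[:f z:]"]) auto
next
  case (Suc m)
  then obtain z Z' where Z: "Z = insert z Z'" "z \<notin> Z'" "card Z' = Suc m" "finite Z'"
    by (metis card_Suc_eq_finite)
  from Suc.IH[OF Z(4,3)] obtain p where p: "degree p \<le> m" "\<forall>y\<in>Z'. poly p y = f y" by blast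
  define w where "w = (\<Prod>y\<in>Z'. [:-y, 1:])"
  have pw: "poly w y = (\<Prod>x\<in>Z'. y - x)" for y by (simp add: w_def poly_prod)
  have "degree w = Suc m" unfolding w_def by (subst degree_prod_sum_eq) (use Z(3) in auto)
  then have "degree (p + smult ((f z - poly p z) / poly w z) w) \<le> Suc m"
    using p(1) degree_smult_le by (intro degree_add_le order.trans[OF degree_smult_le]) auto
  moreover have "poly w z \<noteq> 0" using Z by (auto simp: pw)
  ultimately show ?case
    using p(2) Z by (intro exI[of _ "p + smult ((f z - poly p z) / poly w z) w"]) (auto simp: pw)
qed

section \<open>Oscillatory integrals\<close>

text \<open>In the two integrations by parts the boundary terms in \<open>F\<close> vanish, those in
  \<open>F1\<close> give \<open>2 * B1\<close>, and the remaining integral of \<open>F2\<close>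
  gives \<open>(b - a) * B2\<close>.\<close>

lemma oscillatory_integral_bound:
  fixes F F1 F2 :: "real \<Rightarrow> real"
  assumes ab: "a \<le> b" and \<kappa>: "\<kappa> > 0"
    and d0: "\<And>x. x \<in> {a..b} \<Longrightarrow> (F has_real_derivative F1 x) (at x within {a..b})"
    and d1: "\<And>x. x \<in> {a..b} \<Longrightarrow> (F1 has_real_derivative F2 x) (at x within {a..b})"
    and zero: "F a = 0" "F b = 0"
    and B1: "\<And>x. x \<in> {a..b} \<Longrightarrow> \<bar>F1 x\<bar> \<le> B1" and B2: "\<And>x. x \<in> {a..b} \<Longrightarrow> \<bar>F2 x\<bar> \<le> B2"
  shows "cmod (integral {a..b} (\<lambda>x. of_real (F x) * exp (\<i> * of_real (\<kappa> * x))))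
           \<le> (2 * B1 + (b - a) * B2) / \<kappa>\<^sup>2"
proof -
  define e where "e = (\<lambda>x::real. exp (\<i> * of_real (\<kappa> * x)))"
  have ne: "cmod (e x) = 1" for x unfolding e_def by (simp add: norm_exp_i_times)
  \<comment> \<open>\<open>\<Phi>' = F e + F'' e / \<kappa>^2\<close>: both integrations by parts in one antiderivative.\<close>
  define \<Phi> where "\<Phi> = (\<lambda>x. e x * (complex_of_real (F x) / (\<i> * \<kappa>) + complex_of_real (F1 x) / \<kappa>\<^sup>2))"
  have de: "(e has_vector_derivative \<i> * \<kappa> * e x) (at x within {a..b})" for x
    unfolding e_def
    by (auto intro!: derivative_eq_intros has_vector_derivative_real_field simp: field_simps)
  have "(\<Phi> has_vector_derivative of_real (F x) * e x + complex_of_real (F2 x) * e x / \<kappa>\<^sup>2) (at x within {a..b})"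
    if x: "x \<in> {a..b}" for x
  proof -
    have v0: "((\<lambda>x. complex_of_real (F x) / (\<i> * \<kappa>)) has_vector_derivative of_real (F1 x) / (\<i> * \<kappa>)) (at x within {a..b})"
      and v1: "((\<lambda>x. complex_of_real (F1 x) / \<kappa>\<^sup>2) has_vector_derivative of_real (F2 x) / \<kappa>\<^sup>2) (at x within {a..b})"
      using d0[OF x] d1[OF x]
      by (auto intro!: has_vector_derivative_of_real has_vector_derivative_divide)
    show ?thesis unfolding \<Phi>_def
      by (rule has_vector_derivative_eq_rhs[OF has_vector_derivative_mult[OF de has_vector_derivative_add[OF v0 v1]]])
        (use \<kappa> in \<open>simp add: field_simps power2_eq_square\<close>)
  qed
  then have I: "((\<lambda>x. of_real (F x) * e x + complex_of_real (F2 x) * e x / \<kappa>\<^sup>2) has_integral (\<Phi> b - \<Phi> a)) {a..b}"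
    by (rule fundamental_theorem_of_calculus[OF ab])
  have "continuous_on {a..b} (\<lambda>x. of_real (F x) * e x)"
    unfolding e_def using DERIV_continuous_on[OF d0] by (intro continuous_intros) auto
  then have IF: "((\<lambda>x. of_real (F x) * e x) has_integral integral {a..b} (\<lambda>x. of_real (F x) * e x)) {a..b}"
    using integrable_continuous_real integrable_integral by blast
  \<comment> \<open>The \<open>F2\<close> term gets its integral by subtraction: the whole
    derivative of \<open>\<Phi>\<close> and the continuous \<open>F\<close> term both have
    one.\<close>
  have "cmod (\<Phi> b - \<Phi> a - integral {a..b} (\<lambda>x. of_real (F x) * e x)) \<le> B2 / \<kappa>\<^sup>2 * measure lborel (cbox a b)"
  proof (rule has_integral_bound)
    show "((\<lambda>x. complex_of_real (F2 x) * e x / \<kappa>\<^sup>2) has_integral \<Phi> b - \<Phi> a - integral {a..b} (\<lambda>x. of_real (F x) * e x)) (cbox a b)"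
      using has_integral_diff[OF I IF] by simp
    show "0 \<le> B2 / \<kappa>\<^sup>2" using B2[of a] ab by simp
    show "cmod (complex_of_real (F2 x) * e x / \<kappa>\<^sup>2) \<le> B2 / \<kappa>\<^sup>2" if "x \<in> cbox a b" for x
      using B2[of x] that by (simp add: norm_mult norm_divide ne norm_power divide_right_mono)
  qed
  moreover have "cmod (\<Phi> x) \<le> B1 / \<kappa>\<^sup>2" if "x \<in> {a, b}" for x
    using zero B1[of x] that ab by (auto simp: \<Phi>_def norm_mult norm_divide ne norm_power divide_right_mono)
  then have "cmod (\<Phi> a) \<le> B1 / \<kappa>\<^sup>2" "cmod (\<Phi> b) \<le> B1 / \<kappa>\<^sup>2" by simp_all
  moreover have "cmod I \<le> cmod (\<Phi> b) + cmod (\<Phi> a) + cmod (\<Phi> b - \<Phi> a - I)" for I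
    using norm_triangle_ineq4[of "\<Phi> b" "\<Phi> a"] norm_triangle_ineq4[of "\<Phi> b - \<Phi> a" "\<Phi> b - \<Phi> a - I"]
    by simp
  ultimately have "cmod (integral {a..b} (\<lambda>x. of_real (F x) * e x)) \<le> B1 / \<kappa>\<^sup>2 + B1 / \<kappa>\<^sup>2 + B2 / \<kappa>\<^sup>2 * (b - a)"
    using ab by (smt (verit) content_real box_real(2))
  also have "\<dots> = (2 * B1 + (b - a) * B2) / \<kappa>\<^sup>2" using \<kappa> by (simp add: divide_simps)
  finally show ?thesis unfolding e_def .
qed

text \<open>With the endpoints among the nodes, the error \<open>F 0\<close> meets the boundary
  condition of \<open>oscillatory_integral_bound\<close>. Rolle's theorem leaves \<open>m\<close>
  zeros for \<open>F 1\<close> and \<open>m - 1\<close> for \<open>F 2\<close>, so both are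
  controlled by the derivative of order \<open>m + 1\<close>.\<close>

lemma interpolatory_filon_error:
  fixes D :: "nat \<Rightarrow> real \<Rightarrow> real" and p :: "real poly"
  assumes ab: "a \<le> b" and \<kappa>: "\<kappa> > 0" and m: "m \<ge> 1"
    and deriv: "\<And>k x. k \<le> m \<Longrightarrow> x \<in> {a..b} \<Longrightarrow> (D k has_real_derivative D (Suc k) x) (at x within {a..b})"
    and bound: "\<And>x. x \<in> {a..b} \<Longrightarrow> \<bar>D (Suc m) x\<bar> \<le> S"
    and Z: "finite Z" "Z \<subseteq> {a..b}" "card Z = Suc m" "a \<in> Z" "b \<in> Z"
    and p: "degree p \<le> m" "\<And>z. z \<in> Z \<Longrightarrow> poly p z = D 0 z"
  shows "cmod (integral {a..b} (\<lambda>x. of_real (D 0 x) * exp (\<i> * of_real (\<kappa> * x)))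
             - integral {a..b} (\<lambda>x. of_real (poly p x) * exp (\<i> * of_real (\<kappa> * x))))
          \<le> (real m + 2) * S * (b - a) ^ m / fact m / \<kappa>\<^sup>2"
proof -
  define F where "F = (\<lambda>k x. D k x - poly ((pderiv ^^ k) p) x)"
  have dF: "(F k has_real_derivative F (Suc k) x) (at x within {a..b})" if "k \<le> m" "x \<in> {a..b}" for k x
    unfolding F_def by (auto intro!: derivative_eq_intros deriv that poly_DERIV[THEN DERIV_subset])
  have F_top: "\<bar>F (Suc m) x\<bar> \<le> S" if "x \<in> {a..b}" for x
    using bound[OF that] p(1) higher_pderiv_eq_0[of p "Suc m"] by (simp add: F_def del: funpow.simps)
  have F0: "F 0 z = 0" if "z \<in> Z" for z using p(2) that by (simp add: F_def)
  obtain Z1 where Z1: "finite Z1" "Z1 \<subseteq> {a..b}" "card Z1 = m" "\<And>z. z \<in> Z1 \<Longrightarrow> F 1 z = 0"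
    by (rule rolle_zeros[of a b "F 0" "F 1" Z]) (use dF[of 0] Z F0 in auto)
  obtain Z2 where Z2: "finite Z2" "Z2 \<subseteq> {a..b}" "card Z2 = m - 1" "\<And>z. z \<in> Z2 \<Longrightarrow> F 2 z = 0"
    by (rule rolle_zeros[of a b "F 1" "F 2" Z1]) (use dF[of 1] m Z1 in \<open>auto simp: numeral_2_eq_2\<close>)
  have B1: "\<bar>F 1 x\<bar> \<le> S * (b - a) ^ m / fact m" if "x \<in> {a..b}" for x
    using interpolation_error_bound[of m a b "\<lambda>k. F (Suc k)" Z1 S x] dF F_top Z1 that by simp
  \<comment> \<open>For \<open>m = 1\<close> the set \<open>Z2\<close> is empty and the bound is
    \<open>S\<close> itself.\<close>
  have B2: "\<bar>F 2 x\<bar> \<le> S * (b - a) ^ (m - 1) / fact (m - 1)" if "x \<in> {a..b}" for x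
    using interpolation_error_bound[of "m - 1" a b "\<lambda>k. F (k + 2)" Z2 S x] dF F_top Z2 that m
    by (simp add: numeral_2_eq_2)
  have "cmod (integral {a..b} (\<lambda>x. of_real (F 0 x) * exp (\<i> * of_real (\<kappa> * x))))
     \<le> (2 * (S * (b - a) ^ m / fact m) + (b - a) * (S * (b - a) ^ (m - 1) / fact (m - 1))) / \<kappa>\<^sup>2"
    by (rule oscillatory_integral_bound[where ?F1.0 = "F 1" and ?F2.0 = "F 2"])
      (use ab \<kappa> dF[of 0] dF[of 1] m B1 B2 F0 Z in \<open>auto simp: numeral_2_eq_2\<close>)
  \<comment> \<open>Here \<open>2 / m! + 1 / (m - 1)! = (m + 2) / m!\<close>.\<close>
  also have "\<dots> = (real m + 2) * S * (b - a) ^ m / fact m / \<kappa>\<^sup>2"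
  proof -
    obtain q where "m = Suc q" using m by (cases m) auto
    moreover have "(1 + real q) * fact q = fact m" using \<open>m = Suc q\<close> by simp
    ultimately show ?thesis by (simp add: divide_simps) (simp add: algebra_simps)
  qed
  also have "integral {a..b} (\<lambda>x. of_real (F 0 x) * exp (\<i> * of_real (\<kappa> * x)))
    = integral {a..b} (\<lambda>x. of_real (D 0 x) * exp (\<i> * of_real (\<kappa> * x)))
             - integral {a..b} (\<lambda>x. of_real (poly p x) * exp (\<i> * of_real (\<kappa> * x)))"
  proof -
    have "continuous_on {a..b} (D 0)" using deriv[of 0] DERIV_continuous_on by blast
    then show ?thesis unfolding F_def
      by (subst integral_diff[symmetric])
        (auto intro!: integrable_continuous_real continuous_intros simp: algebra_simps)
  qed
  finally show ?thesis .
qed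

section \<open>Derivatives within an interval and bounds by repeated integration\<close>

lemma C_k_on_has_real_derivative:
  assumes "C_k_on n S \<phi>" "k < n" "x \<in> S"
  shows "(nth_deriv_on S k \<phi> has_real_derivative nth_deriv_on S (Suc k) \<phi> x) (at x within S)"
  using assms
  by (auto simp: C_k_on_def differentiable_on_def nth_deriv_on_def vector_derivative_works
      has_real_derivative_iff_has_vector_derivative)

lemma mvt_within:
  fixes f :: "real \<Rightarrow> real"
  assumes "a \<le> b" and "\<And>x. x \<in> {a..b} \<Longrightarrow> (f has_real_derivative f' x) (at x within {a..b})"
  obtains x where "x \<in> {a..b}" "f b - f a = f' x * (b - a)"
  using mvt_very_simple[of a b f "\<lambda>x. (*) (f' x)"] assms by (auto simp: has_field_derivative_def)

text \<open>A bound on the \<open>n\<close>-th derivative is integrated \<open>i\<close> times from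
  0, where all lower derivatives vanish. The sign of \<open>c\<close> is free, so negated functions
  yield upper bounds.\<close>

lemma derivatives_lower_bound:
  fixes G :: "nat \<Rightarrow> real \<Rightarrow> real"
  assumes deriv: "\<And>k x. k < n \<Longrightarrow> x \<in> {0..1} \<Longrightarrow> (G k has_real_derivative G (Suc k) x) (at x within {0..1})"
    and zero: "\<And>k. k < n \<Longrightarrow> G k 0 = 0"
    and top: "\<And>x. x \<in> {0..1} \<Longrightarrow> c \<le> G n x"
    and "i \<le> n" "x \<in> {0..1}"
  shows "c * x ^ i / fact i \<le> G (n - i) x"
  using assms(4,5)
proof (induction i arbitrary: x)
  case 0
  then show ?case using top by simp
next
  case (Suc i)
  define k where "k = n - Suc i"
  have k: "k < n" "Suc k = n - i" using Suc.prems by (auto simp: k_def)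
  define u where "u = (\<lambda>x. G k x - c * x ^ Suc i / fact (Suc i))"
  have "((\<lambda>x. c * x ^ Suc i / fact (Suc i)) has_real_derivative c * x ^ i / fact i) (at x within {0..1})" for x
  proof -
    have "((\<lambda>x. c * x ^ Suc i / fact (Suc i)) has_real_derivative
        c * (real (Suc i) * x ^ (Suc i - Suc 0)) / fact (Suc i)) (at x within {0..1})"
      by (intro DERIV_cdivide DERIV_cmult DERIV_pow)
    also have "c * (real (Suc i) * x ^ (Suc i - Suc 0)) / fact (Suc i) = c * x ^ i / fact i"
      by (simp add: divide_simps fact_Suc del: of_nat_Suc)
    finally show ?thesis .
  qed
  then have du: "(u has_real_derivative G (n - i) y - c * y ^ i / fact i) (at y within {0..1})"
    if "y \<in> {0..1}" for y
    unfolding u_def using deriv[OF k(1) that] k(2) by (intro DERIV_diff) simp_all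
  \<comment> \<open>The induction hypothesis makes the derivative of \<open>u\<close> nonnegative,
    and \<open>u 0 = 0\<close>.\<close>
  obtain y where y: "y \<in> {0..x}" "u x - u 0 = (G (n - i) y - c * y ^ i / fact i) * (x - 0)"
  proof (rule mvt_within[of 0 x u "\<lambda>y. G (n - i) y - c * y ^ i / fact i"])
    show "(u has_real_derivative G (n - i) y - c * y ^ i / fact i) (at y within {0..x})"
      if "y \<in> {0..x}" for y
      using that Suc.prems(2) by (intro DERIV_subset[OF du]) auto
  qed (use Suc.prems in auto)
  have "0 \<le> u x - u 0"
    using y Suc.IH[of y] Suc.prems by simp
  then show ?case using zero[OF k(1)] by (simp add: u_def k_def)
qed

section \<open>Partitions of an interval and node sequences\<close>

lemma has_integral_combine_partition:
  fixes h :: "real \<Rightarrow> 'a::banach"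
  assumes "\<And>i. i < N \<Longrightarrow> p i \<le> p (Suc i)"
    and "\<And>i. i \<in> {1..N} \<Longrightarrow> (h has_integral I i) {p (i - 1)..p i}"
  shows "(h has_integral (\<Sum>i=1..N. I i)) {p 0..p N} \<and> p 0 \<le> p N"
  using assms
proof (induction N)
  case 0
  then show ?case using has_integral_null_real[of "p 0" "p 0" h] by simp
next
  case (Suc N)
  \<comment> \<open>The order \<open>p 0 \<le> p N\<close> is carried through the induction because
    joining two integrals requires ordered endpoints.\<close>
  have "(h has_integral (\<Sum>i=1..N. I i)) {p 0..p N}" "p 0 \<le> p N" "p N \<le> p (Suc N)"
    using Suc by auto
  moreover have "(h has_integral I (Suc N)) {p N..p (Suc N)}" using Suc.prems(2)[of "Suc N"] by simp
  ultimately show ?case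
    using has_integral_combine[of "p 0" "p N" "p (Suc N)" h "\<Sum>i=1..N. I i" "I (Suc N)"] by simp
qed

lemma filon_nodes_less:
  assumes "filon_nodes m a b t" "i < k" "k \<le> m"
  shows "t i < t k"
  using assms(2,3)
proof (induction k)
  case (Suc k)
  then have "t k < t (Suc k)" using assms(1) by (simp add: filon_nodes_def)
  then show ?case using Suc by (cases "i = k") auto
qed simp

lemma filon_nodes_mem:
  assumes "filon_nodes m a b t" "k \<le> m"
  shows "t k \<in> {a..b}"
  using assms filon_nodes_less[OF assms(1), of 0 k] filon_nodes_less[OF assms(1), of k m]
  by (cases "k = 0"; cases "k = m") (auto simp: filon_nodes_def)

lemma equi_point_0 [simp]: "equi_point a b N 0 = a"
  by (simp add: equi_point_def)

lemma equi_point_last [simp]: "N \<noteq> 0 \<Longrightarrow> equi_point a b N N = b"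
  by (simp add: equi_point_def)

lemma equi_point_mono: "a \<le> b \<Longrightarrow> i \<le> k \<Longrightarrow> equi_point a b N i \<le> equi_point a b N k"
  by (auto simp: equi_point_def intro!: divide_right_mono mult_left_mono)

lemma equi_point_diff: "i \<ge> 1 \<Longrightarrow> equi_point a b N i - equi_point a b N (i - 1) = (b - a) / real N"
  by (simp add: equi_point_def diff_divide_distrib[symmetric] right_diff_distrib[symmetric] of_nat_diff)

section \<open>Filon rules for an oscillator with a stationary point at the origin\<close>

locale filon_setting =
  fixes r :: nat and f g :: "real \<Rightarrow> real" and \<alpha> :: real
  assumes r: "r > 0"
    and smooth: "C_k_on (r + 1) {0..1} g"
    and flat: "\<forall>j\<in>{0..r}. nth_deriv_on {0..1} j g 0 = 0"
    and top_nonzero: "\<forall>x\<in>{0..1}. nth_deriv_on {0..1} (r + 1) g x \<noteq> 0"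
    and mono: "mono_on {0..1} g"
    and no_inflection: "no_inflection_point g"
    and \<alpha>: "\<alpha> \<in> {-1<..<1}"
    and type: "type_infinity_zero \<alpha> (Theta f g)"
begin

abbreviation "\<sigma> \<equiv> sigma_osc r g"
abbreviation "\<delta> \<equiv> delta_osc r g"
abbreviation G where "G k \<equiv> nth_deriv_on {0..1} k g"

lemma G_0 [simp]: "G 0 = g"
  by (simp add: nth_deriv_on_def)

lemma G_deriv:
  "k < r + 1 \<Longrightarrow> x \<in> {0..1} \<Longrightarrow> (G k has_real_derivative G (Suc k) x) (at x within {0..1})"
  using C_k_on_has_real_derivative[OF smooth] .

section \<open>Two-sided bounds for the oscillator and its derivative\<close>

lemma continuous_top: "continuous_on {0..1} (\<lambda>x. \<bar>G (r + 1) x\<bar> / fact (r + 1))"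
  using smooth by (auto simp: C_k_on_def intro!: continuous_intros)

lemma delta_le_top: "x \<in> {0..1} \<Longrightarrow> \<delta> * fact (r + 1) \<le> \<bar>G (r + 1) x\<bar>"
  and top_le_sigma: "x \<in> {0..1} \<Longrightarrow> \<bar>G (r + 1) x\<bar> \<le> \<sigma> * fact (r + 1)"
proof -
  assume x: "x \<in> {0..1}"
  have "bounded ((\<lambda>x. \<bar>G (r + 1) x\<bar> / fact (r + 1)) ` {0..1})"
    by (intro compact_imp_bounded compact_continuous_image continuous_top compact_Icc)
  then have "bdd_below ((\<lambda>x. \<bar>G (r + 1) x\<bar> / fact (r + 1)) ` {0..1})"
    and "bdd_above ((\<lambda>x. \<bar>G (r + 1) x\<bar> / fact (r + 1)) ` {0..1})"
    by (auto intro: bounded_imp_bdd_below bounded_imp_bdd_above)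
  then have "\<delta> \<le> \<bar>G (r + 1) x\<bar> / fact (r + 1)" "\<bar>G (r + 1) x\<bar> / fact (r + 1) \<le> \<sigma>"
    unfolding delta_osc_def sigma_osc_def by (auto intro!: cINF_lower cSUP_upper x)
  then show "\<delta> * fact (r + 1) \<le> \<bar>G (r + 1) x\<bar>" "\<bar>G (r + 1) x\<bar> \<le> \<sigma> * fact (r + 1)"
    by (simp_all add: pos_le_divide_eq pos_divide_le_eq del: fact_Suc)
qed

lemma delta_pos: "0 < \<delta>"
proof -
  obtain x where x: "x \<in> {0..1}"
    "\<And>y. y \<in> {0..1} \<Longrightarrow> \<bar>G (r + 1) x\<bar> / fact (r + 1) \<le> \<bar>G (r + 1) y\<bar> / fact (r + 1)"
    using continuous_attains_inf[OF _ _ continuous_top] by fastforce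
  have "0 < \<bar>G (r + 1) x\<bar> / fact (r + 1)" using top_nonzero x(1) by simp
  also have "\<dots> \<le> \<delta>" unfolding delta_osc_def by (intro cINF_greatest x(2)) auto
  finally show ?thesis .
qed

text \<open>A continuous function without zeros keeps one sign. Were it negative,
  \<open>r + 1\<close> integrations from 0 would give \<open>g 1 \<le> - \<delta>\<close>, against
  monotonicity and \<open>g 0 = 0\<close>.\<close>

lemma top_pos:
  assumes "x \<in> {0..1}"
  shows "0 < G (r + 1) x"
proof (rule ccontr)
  assume "\<not> 0 < G (r + 1) x"
  then have neg: "G (r + 1) x < 0" using top_nonzero assms by force
  have "connected (G (r + 1) ` {0..1})"
    using smooth by (intro connected_continuous_image) (auto simp: C_k_on_def)
  then have all_neg: "G (r + 1) y < 0" if y: "y \<in> {0..1}" for y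
  proof -
    have False if "G (r + 1) y \<ge> 0"
      using connectedD_interval[of "G (r + 1) ` {0..1}" "G (r + 1) x" "G (r + 1) y" 0]
        \<open>connected _\<close> neg assms y that top_nonzero by force
    then show ?thesis by force
  qed
  have "\<delta> * fact (r + 1) * 1 ^ (r + 1) / fact (r + 1) \<le> - G (r + 1 - (r + 1)) 1"
  proof (rule derivatives_lower_bound[where G = "\<lambda>k x. - G k x"])
    show "((\<lambda>x. - G k x) has_real_derivative - G (Suc k) x) (at x within {0..1})"
      if "k < r + 1" "x \<in> {0..1}" for k x using DERIV_minus[OF G_deriv[OF that]] .
    show "\<delta> * fact (r + 1) \<le> - G (r + 1) x" if "x \<in> {0..1}" for x
      using delta_le_top[OF that] all_neg[OF that] by simp
  qed (use flat in auto)
  then have "\<delta> \<le> - g 1" by simp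
  moreover have "g 0 \<le> g 1" using mono by (auto simp: mono_on_def)
  moreover have "g 0 = 0" using bspec[OF flat, of 0] by simp
  ultimately show False using delta_pos by simp
qed

lemma G_lower: "x \<in> {0..1} \<Longrightarrow> i \<le> r + 1 \<Longrightarrow> \<delta> * fact (r + 1) * x ^ i / fact i \<le> G (r + 1 - i) x"
proof (rule derivatives_lower_bound[where G = G])
  show "\<delta> * fact (r + 1) \<le> G (r + 1) x" if "x \<in> {0..1}" for x
    using delta_le_top[OF that] top_pos[OF that] by simp
qed (use flat G_deriv in auto)

text \<open>The lower bound for the negated derivatives, with a negative constant.\<close>

lemma G_upper:
  assumes "x \<in> {0..1}" "i \<le> r + 1"
  shows "G (r + 1 - i) x \<le> \<sigma> * fact (r + 1) * x ^ i / fact i"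
proof -
  have "- (\<sigma> * fact (r + 1)) * x ^ i / fact i \<le> - G (r + 1 - i) x"
  proof (rule derivatives_lower_bound[where G = "\<lambda>k x. - G k x"])
    show "((\<lambda>x. - G k x) has_real_derivative - G (Suc k) x) (at x within {0..1})"
      if "k < r + 1" "x \<in> {0..1}" for k x using DERIV_minus[OF G_deriv[OF that]] .
    show "- (\<sigma> * fact (r + 1)) \<le> - G (r + 1) x" if "x \<in> {0..1}" for x
      using top_le_sigma[OF that] by simp
  qed (use flat assms in auto)
  then show ?thesis by simp
qed

lemma g_lower: "x \<in> {0..1} \<Longrightarrow> \<delta> * x ^ (r + 1) \<le> g x"
  using G_lower[of x "r + 1"] by simp

lemma g'_lower: "x \<in> {0..1} \<Longrightarrow> real (r + 1) * \<delta> * x ^ r \<le> G 1 x"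
  using G_lower[of x r] by (simp add: mult_ac)

lemma g'_upper: "x \<in> {0..1} \<Longrightarrow> G 1 x \<le> real (r + 1) * \<sigma> * x ^ r"
  using G_upper[of x r] by (simp add: mult_ac)

lemma g'_pos:
  assumes "x \<in> {0<..1}"
  shows "0 < G 1 x"
proof -
  have "0 < real (r + 1) * \<delta> * x ^ r" using assms delta_pos by simp
  then show ?thesis using g'_lower[of x] assms by simp
qed

lemma g_pos:
  assumes "x \<in> {0<..1}"
  shows "0 < g x"
proof -
  have "0 < \<delta> * x ^ (r + 1)" using assms delta_pos by simp
  then show ?thesis using g_lower[of x] assms by simp
qed

lemma g1_pos: "0 < g 1"
  using g_pos[of 1] by simp

lemma sigma_pos: "0 < \<sigma>"
proof -
  have "0 < real (r + 1) * \<sigma>" using g'_pos[of 1] g'_upper[of 1] by simp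
  then show ?thesis by (simp add: zero_less_mult_iff)
qed

lemma g_deriv:
  assumes "x \<in> {a..b}" "0 \<le> a" "b \<le> 1"
  shows "(g has_real_derivative G 1 x) (at x within {a..b})"
  using DERIV_subset[OF G_deriv[of 0 x]] assms by simp

text \<open>Since \<open>r > 0\<close>, the derivative vanishes at 0, whereas it is positive at 1;
  this excludes the decreasing alternative.\<close>

lemma g'_mono: "mono_on {0..1} (G 1)"
proof -
  have "\<not> antimono_on {0..1} (G 1)"
  proof
    assume "antimono_on {0..1} (G 1)"
    then have "G 1 1 \<le> G 1 0" by (auto simp: monotone_on_def)
    then show False using g'_pos[of 1] bspec[OF flat, of 1] r by simp
  qed
  then show ?thesis using no_inflection by (auto simp: no_inflection_point_def)
qed

text \<open>The derivative increases, so its value at the right end \<open>x\<close> of a whole mesh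
  cell serves for all pieces of the cell.\<close>

lemma g_diff_le:
  assumes "a \<le> b" "b \<le> x" "0 \<le> a" "x \<le> 1"
  shows "g b - g a \<le> G 1 x * (b - a)"
proof -
  obtain y where y: "y \<in> {a..b}" "g b - g a = G 1 y * (b - a)"
    by (rule mvt_within[of a b g "G 1"]) (use assms g_deriv in auto)
  have "G 1 y \<le> G 1 x" using g'_mono y assms by (auto simp: mono_on_def)
  then show ?thesis using y assms by (simp add: mult_right_mono)
qed

lemma g_strict_mono: "strict_mono_on {0..1} g"
proof (rule strict_mono_onI)
  fix a b :: real
  assume ab: "a \<in> {0..1}" "b \<in> {0..1}" "a < b"
  \<comment> \<open>The derivative vanishes at 0, so the mean value theorem is applied on the right
    half only, where it is positive.\<close>
  define c where "c = (a + b) / 2"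
  have c: "a < c" "c < b" using ab by (auto simp: c_def)
  obtain y where y: "y \<in> {c..b}" "g b - g c = G 1 y * (b - c)"
    by (rule mvt_within[of c b g "G 1"]) (use ab c g_deriv in auto)
  have "0 < G 1 y" using g'_pos y ab c by simp
  then have "g c < g b" using y c by (metis diff_gt_0_iff_gt mult_pos_pos)
  moreover have "g a \<le> g c" using mono ab c by (auto simp: mono_on_def)
  ultimately show "g a < g b" by simp
qed

lemma g_inj: "inj_on g {0..1}"
  using g_strict_mono strict_mono_on_imp_inj_on by blast

lemma Psi_g: "x \<in> {0..1} \<Longrightarrow> Psi f g (g x) = f x / G 1 x"
  by (simp add: Psi_def the_inv_into_f_f[OF g_inj])

text \<open>The derivatives of \<open>\<Psi>\<close>, obtained from those of \<open>\<Theta>\<close> by scaling.\<close>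

definition P :: "nat \<Rightarrow> real \<Rightarrow> real" where
  "P k y = nth_deriv_on {0<..1} k (Theta f g) (y / g 1) / g 1 ^ k"

lemma P_0: "P 0 = Psi f g"
  using g1_pos by (auto simp: P_def nth_deriv_on_def Theta_def)

lemma P_deriv:
  assumes "y \<in> {a..b}" "0 < a" "b \<le> g 1"
  shows "(P k has_real_derivative P (Suc k) y) (at y within {a..b})"
proof -
  let ?q = "\<lambda>y. y / g 1"
  have sub: "?q ` {a..b} \<subseteq> {0<..1}" using assms g1_pos by (intro image_subsetI) auto
  have "C_k_on (Suc k) {0<..1} (Theta f g)"
    using type by (simp add: type_infinity_zero_def C_infinity_on_def)
  then have "(nth_deriv_on {0<..1} k (Theta f g) has_real_derivative
      nth_deriv_on {0<..1} (Suc k) (Theta f g) (?q y)) (at (?q y) within ?q ` {a..b})"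
    by (intro DERIV_subset[OF C_k_on_has_real_derivative sub]) (use assms sub in auto)
  then have "(nth_deriv_on {0<..1} k (Theta f g) \<circ> ?q has_real_derivative
      nth_deriv_on {0<..1} (Suc k) (Theta f g) (?q y) * (1 / g 1)) (at y within {a..b})"
    by (rule DERIV_image_chain) (use g1_pos in \<open>auto intro!: derivative_eq_intros\<close>)
  then have "((\<lambda>y. (nth_deriv_on {0<..1} k (Theta f g) \<circ> ?q) y / g 1 ^ k) has_real_derivative
      nth_deriv_on {0<..1} (Suc k) (Theta f g) (?q y) * (1 / g 1) / g 1 ^ k) (at y within {a..b})"
    by (rule DERIV_cdivide)
  then show ?thesis by (simp add: P_def[abs_def] o_def mult.commute)
qed

text \<open>A constant for the Type condition, fixed in a context without \<kappa> and
  \<open>n\<close>; this makes the final constant uniform in both.\<close>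

definition C where
  "C = (SOME c. c > 0 \<and> (\<forall>x\<in>{0<..1}. \<forall>k\<ge>1.
     \<bar>nth_deriv_on {0<..1} k (Theta f g) x\<bar> \<le> c * x powr (\<alpha> - real k)))"

lemma C_spec: "C > 0"
  "x \<in> {0<..1} \<Longrightarrow> k \<ge> 1 \<Longrightarrow> \<bar>nth_deriv_on {0<..1} k (Theta f g) x\<bar> \<le> C * x powr (\<alpha> - real k)"
proof -
  have "C > 0 \<and> (\<forall>x\<in>{0<..1}. \<forall>k\<ge>1.
     \<bar>nth_deriv_on {0<..1} k (Theta f g) x\<bar> \<le> C * x powr (\<alpha> - real k))"
    unfolding C_def by (rule someI_ex) (use type in \<open>auto simp: type_infinity_zero_def\<close>)
  then show "C > 0"
    "x \<in> {0<..1} \<Longrightarrow> k \<ge> 1 \<Longrightarrow> \<bar>nth_deriv_on {0<..1} k (Theta f g) x\<bar> \<le> C * x powr (\<alpha> - real k)"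
    by blast+
qed

text \<open>The power \<open>g 1 powr (k - \<alpha>)\<close> from rescaling the argument meets
  \<open>g 1 powr (- k)\<close> from the chain rule and leaves \<open>g 1 powr (- \<alpha>)\<close>
  for every \<open>k\<close>.\<close>

lemma P_bound:
  assumes "y \<in> {0<..g 1}" "k \<ge> 1"
  shows "\<bar>P k y\<bar> \<le> C * g 1 powr (- \<alpha>) * y powr (\<alpha> - real k)"
proof -
  have "\<bar>P k y\<bar> \<le> C * (y / g 1) powr (\<alpha> - real k) / g 1 ^ k"
    using C_spec(2)[of "y / g 1" k] assms g1_pos by (auto simp: P_def abs_divide intro!: divide_right_mono)
  also have "(y / g 1) powr (\<alpha> - real k) = y powr (\<alpha> - real k) * g 1 powr (- (\<alpha> - real k))"
    using assms g1_pos unfolding powr_minus_divide by (simp add: powr_divide)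
  also have "C * (y powr (\<alpha> - real k) * g 1 powr (- (\<alpha> - real k))) / g 1 ^ k
      = C * y powr (\<alpha> - real k) * (g 1 powr (- (\<alpha> - real k)) * g 1 powr (- real k))"
    using g1_pos by (simp add: powr_minus_divide[of _ "real k"] powr_realpow)
  also have "g 1 powr (- (\<alpha> - real k)) * g 1 powr (- real k) = g 1 powr (- \<alpha>)"
    by (subst powr_add[symmetric]) simp
  finally show ?thesis by (simp add: mult_ac)
qed

section \<open>Errors of the basic rule and of its repetition on equal pieces\<close>

text \<open>Here \<open>x0\<close> will be the left end of the mesh cell containing
  \<open>{a..b}\<close>, and \<open>\<tau>\<close> measures the length of the image interval
  relative to \<open>g x0\<close>. The resulting \<open>g x0 ^ m\<close> reduces the derivative
  bound to \<open>g x0 powr (\<alpha> - 1)\<close>.\<close>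

lemma filon_rule_error:
  assumes t: "filon_nodes m a b t" and m: "m \<ge> 1" and ab: "0 < x0" "x0 \<le> a" "a < b" "b \<le> 1"
    and \<kappa>: "\<kappa> > 0" and \<tau>: "g b - g a \<le> \<tau> * g x0"
  shows "\<exists>I. ((\<lambda>x. of_real (f x) * exp (\<i> * of_real (\<kappa> * g x))) has_integral I) {a..b} \<and>
    cmod (I - filon_rule f g \<kappa> m a b t)
      \<le> C * g 1 powr (- \<alpha>) * ((real m + 2) / fact m * \<tau> ^ m * g x0 powr (\<alpha> - 1)) / \<kappa>\<^sup>2"
proof -
  define h where "h = (\<lambda>y. of_real (Psi f g y) * exp (\<i> * of_real (\<kappa> * y)))"
  have gab: "g a < g b" and ga: "0 < g a" and gb: "g b \<le> g 1" and gx0: "0 < g x0" "g x0 \<le> g a"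
    using g_strict_mono mono g_pos ab by (auto simp: strict_mono_on_def mono_on_def)
  have cont: "continuous_on {g a..g b} (Psi f g)"
    using DERIV_continuous_on[of "{g a..g b}" "P 0" "P 1"] P_deriv[of _ "g a" "g b" 0] ga gb
    by (simp add: P_0)
  \<comment> \<open>Substitution \<open>y = g x\<close>; the factor \<open>G 1 x\<close> cancels the
    denominator in \<open>Psi\<close>. Integrability of the original integrand comes with
    it.\<close>
  have "((\<lambda>x. G 1 x *\<^sub>R h (g x)) has_integral integral {g a..g b} h) {a..b}"
  proof (rule has_integral_substitution)
    show "g ` {a..b} \<subseteq> {g a..g b}" using mono ab by (auto simp: mono_on_def)
    show "continuous_on {g a..g b} h" unfolding h_def by (intro continuous_intros cont)
  qed (use ab gab g_deriv in auto)
  moreover have "G 1 x *\<^sub>R h (g x) = of_real (f x) * exp (\<i> * of_real (\<kappa> * g x))" if "x \<in> {a..b}" for x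
    using that ab Psi_g[of x] g'_pos[of x] by (simp add: h_def scaleR_conv_of_real)
  ultimately have I: "((\<lambda>x. of_real (f x) * exp (\<i> * of_real (\<kappa> * g x))) has_integral integral {g a..g b} h) {a..b}"
    by (metis (no_types, lifting) has_integral_cong)
  define Z where "Z = (\<lambda>k. g (t k)) ` {..m}"
  have t_mem: "t k \<in> {a..b}" if "k \<le> m" for k using filon_nodes_mem[OF t that] .
  have inj: "inj_on (\<lambda>k. g (t k)) {..m}"
  proof (rule linorder_inj_onI')
    fix i k assume "i \<in> {..m}" "k \<in> {..m}" "i < k"
    then have "g (t i) < g (t k)"
      using filon_nodes_less[OF t] t_mem[of i] t_mem[of k] ab g_strict_mono
      by (auto simp: strict_mono_on_def)
    then show "g (t i) \<noteq> g (t k)" by simp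
  qed
  have Z: "finite Z" "card Z = Suc m" "Z \<subseteq> {g a..g b}" "g a \<in> Z" "g b \<in> Z"
  proof -
    show "card Z = Suc m" using card_image[OF inj] by (simp add: Z_def)
    show "Z \<subseteq> {g a..g b}"
      using t_mem ab mono by (force simp: Z_def mono_on_def)
    show "g a \<in> Z" "g b \<in> Z"
      using t unfolding Z_def filon_nodes_def by (auto intro: image_eqI[of _ _ 0] image_eqI[of _ _ m])
  qed (simp add: Z_def)
  define p where "p = filon_poly f g m t"
  \<comment> \<open>The node values are distinct, so the interpolant exists uniquely and the
    definite description denotes it.\<close>
  have p: "degree p \<le> m \<and> (\<forall>k\<le>m. poly p (g (t k)) = Psi f g (g (t k)))"
    unfolding p_def filon_poly_def
  proof (rule theI')
    obtain q where q: "degree q \<le> m" "\<forall>z\<in>Z. poly q z = Psi f g z"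
      using interpolating_poly_exists[OF Z(1,2)] by blast
    show "\<exists>!p. degree p \<le> m \<and> (\<forall>k\<le>m. poly p (g (t k)) = Psi f g (g (t k)))"
    proof (rule ex1I[of _ q])
      fix q' assume "degree q' \<le> m \<and> (\<forall>k\<le>m. poly q' (g (t k)) = Psi f g (g (t k)))"
      then show "q' = q" using q Z(2) by (intro poly_eqI_degree[of Z]) (auto simp: Z_def)
    qed (use q in \<open>auto simp: Z_def\<close>)
  qed
  \<comment> \<open>The exponent is negative, so on \<open>{g a..g b}\<close> the power is at most
    its value at \<open>g x0\<close>, which lies no further right than \<open>g a\<close>.\<close>
  define S where "S = C * g 1 powr (- \<alpha>) * g x0 powr (\<alpha> - real (Suc m))"
  have "cmod (integral {g a..g b} (\<lambda>x. of_real (P 0 x) * exp (\<i> * of_real (\<kappa> * x)))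
             - integral {g a..g b} (\<lambda>x. of_real (poly p x) * exp (\<i> * of_real (\<kappa> * x))))
          \<le> (real m + 2) * S * (g b - g a) ^ m / fact m / \<kappa>\<^sup>2"
  proof (rule interpolatory_filon_error)
    show "\<bar>P (Suc m) x\<bar> \<le> S" if "x \<in> {g a..g b}" for x
    proof -
      have "\<bar>P (Suc m) x\<bar> \<le> C * g 1 powr (- \<alpha>) * x powr (\<alpha> - real (Suc m))"
        using that ga gb by (intro P_bound) auto
      also have "\<dots> \<le> S" unfolding S_def
        using that gx0 C_spec(1) \<alpha> by (intro mult_left_mono powr_mono2') auto
      finally show ?thesis .
    qed
  qed (use gab m \<kappa> P_deriv ga gb Z p in \<open>auto simp: P_0 Z_def\<close>)
  also have "\<dots> \<le> (real m + 2) * S * (\<tau> * g x0) ^ m / fact m / \<kappa>\<^sup>2"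
    using \<tau> gab C_spec(1) by (intro divide_right_mono mult_left_mono power_mono) (auto simp: S_def)
  also have "\<dots> = C * g 1 powr (- \<alpha>) *
      ((real m + 2) / fact m * \<tau> ^ m * (g x0 powr (\<alpha> - real (Suc m)) * g x0 ^ m)) / \<kappa>\<^sup>2"
    by (simp add: S_def power_mult_distrib)
  also have "g x0 powr (\<alpha> - real (Suc m)) * g x0 ^ m = g x0 powr (\<alpha> - 1)"
    using gx0 by (simp add: powr_realpow[symmetric] powr_add[symmetric])
  finally show ?thesis
    using I by (auto simp: P_0 h_def p_def filon_rule_def)
qed

text \<open>The condition on \<open>N\<close> keeps the image of each piece no longer than
  \<open>(x1 / x0 - 1) * g x0\<close>. All \<open>N\<close> pieces then share one error
  bound.\<close>

lemma multi_filon_rule_error: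
  assumes t: "multi_filon_nodes N m x0 x1 t" and m: "m \<ge> 1" and x: "0 < x0" "x0 < x1" "x1 \<le> 1"
    and \<kappa>: "\<kappa> > 0" and N: "N \<ge> 1" "G 1 x1 * x0 / g x0 \<le> real N"
  shows "\<exists>I. ((\<lambda>x. of_real (f x) * exp (\<i> * of_real (\<kappa> * g x))) has_integral I) {x0..x1} \<and>
    cmod (I - multi_filon_rule f g N \<kappa> m x0 x1 t)
      \<le> real N * (C * g 1 powr (- \<alpha>) *
          ((real m + 2) / fact m * (x1 / x0 - 1) ^ m * g x0 powr (\<alpha> - 1)) / \<kappa>\<^sup>2)"
proof -
  let ?y = "equi_point x0 x1 N"
  let ?h = "\<lambda>x. of_real (f x) * exp (\<i> * of_real (\<kappa> * g x)) :: complex"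
  let ?E = "C * g 1 powr (- \<alpha>) * ((real m + 2) / fact m * (x1 / x0 - 1) ^ m * g x0 powr (\<alpha> - 1)) / \<kappa>\<^sup>2"
  have ex: "\<exists>I. (?h has_integral I) {?y (i - 1)..?y i} \<and>
      cmod (I - filon_rule f g \<kappa> m (?y (i - 1)) (?y i) (t i)) \<le> ?E" if i: "i \<in> {1..N}" for i
  proof (rule filon_rule_error)
    have d: "?y i - ?y (i - 1) = (x1 - x0) / real N" using i by (intro equi_point_diff) auto
    then show lt: "?y (i - 1) < ?y i" using x N divide_pos_pos[of "x1 - x0" "real N"] by linarith
    show le: "x0 \<le> ?y (i - 1)" using equi_point_mono[of x0 x1 0 "i - 1" N] x by simp
    have le': "?y i \<le> x1" using equi_point_mono[of x0 x1 i N N] x i by auto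
    then show "?y i \<le> 1" using x by simp
    have "g (?y i) - g (?y (i - 1)) \<le> G 1 x1 * (?y i - ?y (i - 1))"
      using lt le le' x by (intro g_diff_le) auto
    also have "\<dots> = G 1 x1 * x0 / g x0 / real N * (x1 / x0 - 1) * g x0"
      using x g_pos[of x0] N unfolding d by (simp add: field_simps)
    also have "\<dots> \<le> 1 * (x1 / x0 - 1) * g x0"
      using x g_pos[of x0] N by (intro mult_right_mono) (auto simp: pos_divide_le_eq mult.commute)
    finally show "g (?y i) - g (?y (i - 1)) \<le> (x1 / x0 - 1) * g x0" by simp
  qed (use t i m x \<kappa> in \<open>auto simp: multi_filon_nodes_def\<close>)
  obtain I where I: "\<forall>i\<in>{1..N}. (?h has_integral I i) {?y (i - 1)..?y i} \<and>
      cmod (I i - filon_rule f g \<kappa> m (?y (i - 1)) (?y i) (t i)) \<le> ?E"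
    using bchoice[OF ballI, OF ex] by (rule exE)
  have "(?h has_integral (\<Sum>i=1..N. I i)) {?y 0..?y N}"
    using has_integral_combine_partition[of N ?y ?h I] I equi_point_mono x by simp
  moreover have "cmod ((\<Sum>i=1..N. I i) - multi_filon_rule f g N \<kappa> m x0 x1 t) \<le> (\<Sum>i=1..N. ?E)"
    unfolding multi_filon_rule_def sum_subtractf[symmetric] by (intro sum_norm_le) (use I in blast)
  ultimately show ?thesis using N by (intro exI[of _ "\<Sum>i=1..N. I i"]) simp
qed

end

section \<open>The composite rule\<close>

text \<open>Each of the \<open>c\<close> extra factors of \<open>fact (n + c)\<close> exceeds
  \<open>n\<close>.\<close>

lemma fact_mult_power_le: "fact n * real n ^ c \<le> fact (n + c)"
proof (induction c)
  case (Suc c)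
  have "fact n * real n ^ Suc c = real n * (fact n * real n ^ c)" by simp
  also have "\<dots> \<le> real (Suc (n + c)) * fact (n + c)" using Suc by (intro mult_mono) auto
  finally show ?case by simp
qed simp

text \<open>The condition on \<open>\<nu>\<close> makes the \<open>c\<close> extra nodes compensate for the growth \<open>\<nu>\<^sup>s\<close> of the derivatives
  of \<open>\<Psi>\<close> near the origin.\<close>

lemma filon_term_bound:
  fixes \<mu> \<nu> s :: real
  assumes \<mu>: "1 \<le> \<mu>" "\<mu> \<le> \<nu>" and n: "n \<ge> 1"
    and cond: "\<nu> * (\<nu> - 1) \<le> (real n - 1) / exp 1"
    and m: "m = n + nat \<lceil>s\<rceil>"
  shows "\<nu> * ((real m + 2) / fact m * (\<mu> - 1) ^ m * \<nu> powr s)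
           \<le> (real n + 1) * (real n + 2) / fact n * (\<mu> - 1) ^ n"
proof -
  define c where "c = nat \<lceil>s\<rceil>"
  have mc: "m = n + c" using m by (simp add: c_def)
  have cond': "\<nu> * (\<nu> - 1) \<le> real n / exp 1"
    using cond by (rule order.trans) (simp add: divide_right_mono)
  have "real n / exp 1 \<le> real n" 
    using mult_left_mono[of 1 "exp 1" "real n"] by (simp add: divide_le_eq)
  \<comment> \<open>A crude bound, which absorbs the leading factor \<open>\<nu>\<close>; that
    factor will stem from the number of pieces in a cell.\<close>
  then have \<nu>: "\<nu> \<le> real n + 1"
  proof (cases "\<nu> \<ge> 2")
    case True
    then have "\<nu> * 1 \<le> \<nu> * (\<nu> - 1)" by (intro mult_left_mono) auto
    then show ?thesis using cond' \<open>real n / exp 1 \<le> real n\<close> by linarith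
  qed (use n in auto)
  \<comment> \<open>As \<open>c \<ge> s\<close>, one factor \<open>\<nu>\<close> can be paired with
    each of the \<open>c\<close> surplus factors \<open>\<mu> - 1\<close>.\<close>
  have "(\<mu> - 1) ^ c * \<nu> powr s \<le> (\<mu> - 1) ^ c * \<nu> ^ c"
    using \<mu> powr_mono[of s "real c" \<nu>]
    by (intro mult_left_mono) (auto simp: c_def powr_realpow real_nat_ceiling_ge)
  also have "\<dots> = (\<nu> * (\<mu> - 1)) ^ c" by (simp add: power_mult_distrib)
  also have "\<dots> \<le> (real n / exp 1) ^ c"
  proof (rule power_mono)
    have "\<nu> * (\<mu> - 1) \<le> \<nu> * (\<nu> - 1)" using \<mu> by (intro mult_left_mono) auto
    then show "\<nu> * (\<mu> - 1) \<le> real n / exp 1" using cond' by simp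
  qed (use \<mu> in auto)
  also have "\<dots> = real n ^ c / exp (real c)" by (simp add: power_divide exp_of_nat_mult[symmetric])
  finally have 1: "(\<mu> - 1) ^ c * \<nu> powr s \<le> real n ^ c / exp (real c)" .
  \<comment> \<open>The factorial absorbs \<open>n ^ c\<close>, and \<open>exp c\<close> absorbs the
    growth of \<open>m + 2\<close> through \<open>1 + c \<le> exp c\<close>.\<close>
  have 2: "(real m + 2) / fact m * (real n ^ c / exp (real c)) \<le> (real n + 2) / fact n"
  proof -
    have "real m + 2 \<le> (real n + 2) * (1 + real c)" by (simp add: mc algebra_simps)
    also have "\<dots> \<le> (real n + 2) * exp (real c)"
      using exp_ge_add_one_self[of "real c"] by (intro mult_left_mono) auto
    finally have "(real m + 2) / fact m * (real n ^ c / exp (real c))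
        \<le> (real n + 2) * exp (real c) / (fact n * real n ^ c) * (real n ^ c / exp (real c))"
      using n fact_mult_power_le[of n c]
      by (intro mult_right_mono frac_le) (auto simp: mc)
    also have "\<dots> = (real n + 2) / fact n" using n by simp
    finally show ?thesis .
  qed
  have "\<nu> * ((real m + 2) / fact m * (\<mu> - 1) ^ m * \<nu> powr s)
      = \<nu> * ((real m + 2) / fact m * ((\<mu> - 1) ^ c * \<nu> powr s)) * (\<mu> - 1) ^ n"
    by (simp add: mc power_add)
  also have "\<dots> \<le> (real n + 1) * ((real n + 2) / fact n) * (\<mu> - 1) ^ n"
    using \<nu> \<mu> order.trans[OF mult_left_mono[OF 1] 2]
    by (intro mult_right_mono mult_mono) auto
  finally show ?thesis by simp
qed

text \<open>Equality holds at \<open>n = 2\<close>, where the induction starts. The bound absorbs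
  the polynomial factors left after summing over \<open>n\<close> cells.\<close>

lemma cubic_le_fact: "real n * (real n + 1) * (real n + 2) \<le> 12 * fact n"
proof -
  have "real n * (real n + 1) * (real n + 2) \<le> 12 * fact n" if "n \<ge> 2"
    using that
  proof (induction n rule: dec_induct)
    case (step n)
    have "real n + 3 \<le> real n * (real n + 1)"
      using mult_right_mono[of 2 "real n" "real n + 1"] step by simp
    then have "real (Suc n) * ((real n + 2) * (real n + 3))
        \<le> real (Suc n) * ((real n + 2) * (real n * (real n + 1)))"
      by (intro mult_left_mono) auto
    also have "\<dots> \<le> real (Suc n) * (12 * fact n)"
      using step by (intro mult_left_mono) (auto simp: mult_ac)
    finally show ?case by (simp add: algebra_simps)
  qed simp
  moreover have "n = 0 \<or> n = 1 \<or> n \<ge> 2" by linarith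
  ultimately show ?thesis by auto
qed

section \<open>The geometric mesh and the number of pieces per cell\<close>

locale filon_mesh = filon_setting +
  fixes \<kappa> :: real and n :: nat
  assumes \<kappa>: "\<kappa> > 1" and n: "n \<ge> 1"
begin

abbreviation "K \<equiv> kappa_sigma r g \<kappa>"
abbreviation x where "x \<equiv> mesh_point r g \<kappa> n"
abbreviation N where "N \<equiv> mesh_count r g \<kappa> n"
abbreviation m where "m \<equiv> mesh_degree \<alpha> n"

text \<open>The ratio of consecutive mesh points; \<open>\<nu>\<close> is the ratio of their powers
  of order \<open>r + 1\<close>, which model the size of \<open>g\<close>.\<close>

definition \<mu> where "\<mu> = K powr (1 / (real n * real (r + 1)))"
definition \<nu> where "\<nu> = K powr (1 / real n)"

lemma K_gt_1: "K > 1"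
  using \<kappa> mult_strict_mono[of 1 \<kappa> 1 \<sigma>] by (auto simp: kappa_sigma_def)

lemma mu_gt_1: "\<mu> > 1"
  using K_gt_1 n powr_less_mono[of 0 "1 / (real n * real (r + 1))" K] by (simp add: \<mu>_def)

lemma mu_power_eq_nu: "\<mu> ^ (r + 1) = \<nu>"
proof -
  have "\<mu> ^ (r + 1) = K powr (real (r + 1) * (1 / (real n * real (r + 1))))"
    unfolding \<mu>_def by (rule powr_power) (use K_gt_1 in auto)
  also have "real (r + 1) * (1 / (real n * real (r + 1))) = 1 / real n" by (simp del: of_nat_add)
  finally show ?thesis by (simp add: \<nu>_def)
qed

lemma mu_power_r: "\<mu> ^ r = K powr (real r / (real n * real (r + 1)))"
  using K_gt_1 mu_gt_1 by (simp add: \<mu>_def powr_power)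

lemma mu_power_n: "\<mu> ^ n = K powr (1 / real (r + 1))"
  using K_gt_1 mu_gt_1 n by (simp add: \<mu>_def powr_power)

lemma mu_le_nu: "\<mu> \<le> \<nu>"
  using power_increasing[of 1 "r + 1" \<mu>] mu_gt_1 unfolding mu_power_eq_nu by simp

lemma mu_r_le_nu: "\<mu> ^ r \<le> \<nu>"
  using power_increasing[of r "r + 1" \<mu>] mu_gt_1 unfolding mu_power_eq_nu by simp

lemma mesh_step: "j \<ge> 1 \<Longrightarrow> x j = \<mu> * x (j - 1)"
proof -
  assume "j \<ge> 1"
  then have "real j / real n - 1 = 1 / real n + (real (j - 1) / real n - 1)"
    by (simp add: of_nat_diff diff_divide_distrib)
  then have "(real j / real n - 1) / real (r + 1)
      = 1 / (real n * real (r + 1)) + (real (j - 1) / real n - 1) / real (r + 1)"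
    by (simp only: add_divide_distrib divide_divide_eq_left)
  then show ?thesis by (simp only: mesh_point_def \<mu>_def powr_add)
qed

lemma mesh_pos: "x j > 0"
  using K_gt_1 by (simp add: mesh_point_def)

lemma mesh_strict: "j \<ge> 1 \<Longrightarrow> x (j - 1) < x j"
  using mesh_step[of j] mesh_pos[of "j - 1"] mu_gt_1 by simp

lemma mesh_last: "x n = 1"
  using n K_gt_1 by (simp add: mesh_point_def)

lemma mesh_0: "x 0 = lambda_osc r g \<kappa>"
  by (simp add: mesh_point_def lambda_osc_def)

lemma mesh_le_1: "j \<le> n \<Longrightarrow> x j \<le> 1"
  using n K_gt_1 powr_mono[of "(real j / real n - 1) / real (r + 1)" 0 K]
  by (simp add: mesh_point_def divide_nonpos_pos)

text \<open>As \<open>G 1\<close> increases, the maximum in \<open>mesh_count\<close> is attained at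
  the right end \<open>x j\<close>. Positivity of the quotient guarantees at least one
  piece.\<close>

lemma mesh_count_bounds:
  assumes "j \<in> {1..n}"
  shows "N j \<ge> 1" "G 1 (x j) * x (j - 1) / g (x (j - 1)) \<le> real (N j)"
    "int (N j) \<le> \<lceil>real (r + 1) * \<mu> ^ r * \<sigma> / \<delta>\<rceil>"
proof -
  have lt: "x (j - 1) < x j" and le1: "x j \<le> 1" and pos: "0 < x (j - 1)"
    using mesh_strict mesh_le_1 mesh_pos assms by auto
  let ?q = "G 1 (x j) * x (j - 1) / g (x (j - 1))"
  have "G 1 (x (j - 1)) \<le> G 1 (x j)"
    using g'_mono lt le1 pos by (auto simp: mono_on_def)
  then have N: "N j = nat \<lceil>?q\<rceil>"
    using g'_pos[of "x j"] g'_pos[of "x (j - 1)"] lt le1 pos by (simp add: mesh_count_def Let_def)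
  have gp: "0 < g (x (j - 1))" using g_pos lt le1 pos by simp
  have q: "?q > 0" using g'_pos[of "x j"] lt le1 pos gp by simp
  then show "N j \<ge> 1" by (simp add: N le_nat_iff)
  show "?q \<le> real (N j)" by (simp add: N real_nat_ceiling_ge)
  \<comment> \<open>After comparison with monomials the mesh enters only through the ratio
    \<open>\<mu>\<close>, so the bound is the same for all cells.\<close>
  have "?q \<le> (real (r + 1) * \<sigma> * x j ^ r) * x (j - 1) / (\<delta> * x (j - 1) ^ (r + 1))"
    using g'_upper[of "x j"] g_lower[of "x (j - 1)"] delta_pos lt le1 pos g'_pos[of "x j"]
    by (intro frac_le mult_right_mono) auto
  also have "\<dots> = real (r + 1) * \<mu> ^ r * \<sigma> / \<delta>"
    using mesh_step[of j] assms pos by (simp add: power_mult_distrib)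
  finally show "int (N j) \<le> \<lceil>real (r + 1) * \<mu> ^ r * \<sigma> / \<delta>\<rceil>"
    using q by (simp add: N ceiling_mono)
qed

section \<open>Error of the composite rule\<close>

lemma mesh_degree_ge: "n \<le> m j"
  by (simp add: mesh_degree_def)

lemma composite_rule_error:
  assumes "composite_nodes g r \<alpha> \<kappa> n t"
  shows "cmod (osc_integral f g r \<kappa> - composite_rule f g r \<alpha> \<kappa> n t)
    \<le> (\<Sum>j=1..n. real (N j) * (C * g 1 powr (- \<alpha>) *
          ((real (m j) + 2) / fact (m j) * (\<mu> - 1) ^ m j * g (x (j - 1)) powr (\<alpha> - 1)) / \<kappa>\<^sup>2))"
proof -
  let ?h = "\<lambda>x. of_real (f x) * exp (\<i> * of_real (\<kappa> * g x)) :: complex"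
  let ?R = "\<lambda>j. multi_filon_rule f g (N j) \<kappa> (m j) (x (j - 1)) (x j) (t j)"
  let ?E = "\<lambda>j. real (N j) * (C * g 1 powr (- \<alpha>) *
      ((real (m j) + 2) / fact (m j) * (\<mu> - 1) ^ m j * g (x (j - 1)) powr (\<alpha> - 1)) / \<kappa>\<^sup>2)"
  have ex: "\<exists>I. (?h has_integral I) {x (j - 1)..x j} \<and> cmod (I - ?R j) \<le> ?E j" if j: "j \<in> {1..n}" for j
  proof -
    \<comment> \<open>Every cell has the same relative length \<open>\<mu> - 1\<close>.\<close>
    have ratio: "\<mu> = x j / x (j - 1)" using mesh_step[of j] j mesh_pos[of "j - 1"] by simp
    show ?thesis unfolding ratio
    proof (rule multi_filon_rule_error)
      show "multi_filon_nodes (N j) (m j) (x (j - 1)) (x j) (t j)"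
        using assms j by (simp add: composite_nodes_def)
      show "1 \<le> m j" using mesh_degree_ge[of j] n by simp
      show "0 < x (j - 1)" by (rule mesh_pos)
      show "x (j - 1) < x j" "x j \<le> 1" using mesh_strict[of j] mesh_le_1[of j] j by simp_all
      show "0 < \<kappa>" using \<kappa> by simp
    qed (fact mesh_count_bounds(1,2)[OF j])+
  qed
  obtain I where I: "\<forall>j\<in>{1..n}. (?h has_integral I j) {x (j - 1)..x j} \<and> cmod (I j - ?R j) \<le> ?E j"
    using bchoice[OF ballI, OF ex] by (rule exE)
  have "(?h has_integral (\<Sum>j=1..n. I j)) {x 0..x n}"
  proof (rule has_integral_combine_partition[THEN conjunct1])
    show "x i \<le> x (Suc i)" for i using mesh_strict[of "Suc i"] by simp
    show "(?h has_integral I j) {x (j - 1)..x j}" if "j \<in> {1..n}" for j using I that by blast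
  qed
  \<comment> \<open>Integrability over the whole interval is assembled from the cells, so
    \<open>integral\<close> takes its genuine value rather than the default 0.\<close>
  then have "osc_integral f g r \<kappa> = (\<Sum>j=1..n. I j)"
    by (simp add: osc_integral_def mesh_0 mesh_last integral_unique)
  then have eq: "osc_integral f g r \<kappa> - composite_rule f g r \<alpha> \<kappa> n t = (\<Sum>j=1..n. I j - ?R j)"
    by (simp add: composite_rule_def sum_subtractf)
  show ?thesis unfolding eq by (rule sum_norm_le) (use I in blast)
qed

text \<open>The part of the bound independent of \<kappa> and \<open>n\<close>: 12 comes from
  \<open>cubic_le_fact\<close>, the bracket from the number of pieces,
  \<open>C * g 1 powr (- \<alpha>)\<close> from the derivatives of \<open>Psi\<close>, and the power
  of \<open>\<delta>\<close> from the lower bound on \<open>g\<close>.\<close>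

definition "A = 12 * (real (r + 1) * \<sigma> / \<delta> + 1) * C * g 1 powr (- \<alpha>) * \<delta> powr (\<alpha> - 1)"

text \<open>All cells receive one bound independent of \<open>j\<close>; the factor \<open>n\<close>
  from their number is absorbed by the factorial.\<close>

lemma composite_rule_error_rate:
  assumes t: "composite_nodes g r \<alpha> \<kappa> n t"
    and cond: "\<nu> * (\<nu> - 1) \<le> (real n - 1) / exp 1"
  shows "cmod (osc_integral f g r \<kappa> - composite_rule f g r \<alpha> \<kappa> n t) \<le> A * (\<mu> - 1) ^ n / \<kappa>\<^sup>2"
proof -
  define B where "B = real (r + 1) * \<sigma> / \<delta>"
  have B: "B > 0" using sigma_pos delta_pos by (simp add: B_def)
  define L where "L = C * g 1 powr (- \<alpha>)"
  have L: "L \<ge> 0" using C_spec(1) by (simp add: L_def)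
  let ?T = "\<lambda>j. (real (m j) + 2) / fact (m j) * (\<mu> - 1) ^ m j"
  have "real (N j) * (L * (?T j * g (x (j - 1)) powr (\<alpha> - 1)) / \<kappa>\<^sup>2)
      \<le> (B + 1) * L * \<delta> powr (\<alpha> - 1) / \<kappa>\<^sup>2 * ((real n + 1) * (real n + 2) / fact n * (\<mu> - 1) ^ n)"
    if j: "j \<in> {1..n}" for j
  proof -
    \<comment> \<open>The ceiling of \<open>s\<close> is the excess of \<open>m j\<close> over
      \<open>n\<close>, and \<open>s\<close> is also the exponent of \<open>\<nu>\<close> by which
      \<open>g powr (\<alpha> - 1)\<close> grows at this cell.\<close>
    define s where "s = (real n + 1 - real j) * (1 - \<alpha>)"
    have "real (N j) \<le> real_of_int \<lceil>real (r + 1) * \<mu> ^ r * \<sigma> / \<delta>\<rceil>"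
      using mesh_count_bounds(3)[OF j] by linarith
    also have "\<dots> \<le> B * \<mu> ^ r + 1"
      using of_int_ceiling_le_add_one[of "real (r + 1) * \<mu> ^ r * \<sigma> / \<delta>"] by (simp add: B_def mult_ac)
    \<comment> \<open>The 1 from rounding up is absorbed because
      \<open>\<nu> \<ge> 1\<close>.\<close>
    also have "\<dots> \<le> B * \<nu> + \<nu>"
      using mu_r_le_nu mu_le_nu mu_gt_1 B by (intro add_mono mult_left_mono) auto
    finally have N_le: "real (N j) \<le> (B + 1) * \<nu>" by (simp add: algebra_simps)
    have x: "x (j - 1) \<in> {0<..1}" using mesh_pos mesh_le_1[of "j - 1"] j by auto
    have "x (j - 1) ^ (r + 1) = K powr (real (r + 1) * ((real (j - 1) / real n - 1) / real (r + 1)))"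
      unfolding mesh_point_def by (rule powr_power) (use K_gt_1 in auto)
    then have xp: "x (j - 1) ^ (r + 1) = K powr (real (j - 1) / real n - 1)"
      by (simp del: of_nat_add power_Suc)
    have "g (x (j - 1)) powr (\<alpha> - 1) \<le> (\<delta> * x (j - 1) ^ (r + 1)) powr (\<alpha> - 1)"
      using x delta_pos \<alpha> g_lower[of "x (j - 1)"] by (intro powr_mono2') auto
    also have "\<dots> = \<delta> powr (\<alpha> - 1) * K powr ((real (j - 1) / real n - 1) * (\<alpha> - 1))"
      unfolding xp using delta_pos by (simp add: powr_mult powr_powr)
    also have "(real (j - 1) / real n - 1) * (\<alpha> - 1) = 1 / real n * s"
      using j n by (simp add: s_def field_simps of_nat_diff)
    also have "K powr (1 / real n * s) = \<nu> powr s" by (simp only: \<nu>_def powr_powr)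
    finally have g_le: "g (x (j - 1)) powr (\<alpha> - 1) \<le> \<delta> powr (\<alpha> - 1) * \<nu> powr s" .
    have T: "?T j \<ge> 0" using mu_gt_1 by simp
    have "real (N j) * (L * (?T j * g (x (j - 1)) powr (\<alpha> - 1)) / \<kappa>\<^sup>2)
        \<le> ((B + 1) * \<nu>) * (L * (?T j * (\<delta> powr (\<alpha> - 1) * \<nu> powr s)) / \<kappa>\<^sup>2)"
      using N_le g_le L T B mu_gt_1 mu_le_nu
      by (intro mult_mono divide_right_mono mult_left_mono) auto
    also have "\<dots> = (B + 1) * L * \<delta> powr (\<alpha> - 1) / \<kappa>\<^sup>2 * (\<nu> * (?T j * \<nu> powr s))"
      by (simp add: mult_ac)
    also have "\<dots> \<le> (B + 1) * L * \<delta> powr (\<alpha> - 1) / \<kappa>\<^sup>2 *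
        ((real n + 1) * (real n + 2) / fact n * (\<mu> - 1) ^ n)"
      using filon_term_bound[OF _ mu_le_nu n cond, of "m j" s] mu_gt_1 B L
      by (intro mult_left_mono) (auto simp: mesh_degree_def s_def)
    finally show ?thesis .
  qed
  then have "(\<Sum>j=1..n. real (N j) * (L * (?T j * g (x (j - 1)) powr (\<alpha> - 1)) / \<kappa>\<^sup>2))
      \<le> (\<Sum>j=1..n. (B + 1) * L * \<delta> powr (\<alpha> - 1) / \<kappa>\<^sup>2 *
            ((real n + 1) * (real n + 2) / fact n * (\<mu> - 1) ^ n))"
    by (intro sum_mono)
  also have "\<dots> = (B + 1) * L * \<delta> powr (\<alpha> - 1) / \<kappa>\<^sup>2 * (\<mu> - 1) ^ n *
      (real n * (real n + 1) * (real n + 2) / fact n)"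
    by simp
  also have "\<dots> \<le> (B + 1) * L * \<delta> powr (\<alpha> - 1) / \<kappa>\<^sup>2 * (\<mu> - 1) ^ n * 12"
    using cubic_le_fact[of n] B L mu_gt_1 by (intro mult_left_mono) (auto simp: pos_divide_le_eq)
  also have "\<dots> = A * (\<mu> - 1) ^ n / \<kappa>\<^sup>2" by (simp add: A_def B_def L_def)
  finally show ?thesis using composite_rule_error[OF t] by (simp add: L_def)
qed

text \<open>By definition \<open>rho_osc\<close> is \<open>1 - 1 / \<mu>\<close>, so
  \<open>\<mu> - 1\<close> is \<open>\<mu>\<close> times \<open>rho_osc\<close>, and
  \<open>\<mu> ^ n\<close> is the stated power of \<open>K\<close>.\<close>

lemma mu_minus_1_power: "(\<mu> - 1) ^ n = K powr (1 / real (r + 1)) * rho_osc r g \<kappa> n ^ n"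
proof -
  have "lambda_osc r g \<kappa> powr (1 / real n) = K powr (- (1 / (real n * real (r + 1))))"
    by (simp add: lambda_osc_def powr_powr mult.commute)
  also have "\<dots> = 1 / \<mu>" by (simp add: \<mu>_def powr_minus_divide)
  finally have "rho_osc r g \<kappa> n = 1 - 1 / \<mu>" by (simp add: rho_osc_def)
  then have "\<mu> - 1 = \<mu> * rho_osc r g \<kappa> n" using mu_gt_1 by (simp add: field_simps)
  then show ?thesis by (simp only: mu_power_n[symmetric] power_mult_distrib[symmetric])
qed

section \<open>Counting the evaluations\<close>

text \<open>Node 0 of every piece is dropped, being the last node of the preceding piece. Only the
  leftmost point \<open>x 0\<close> has no predecessor and is inserted separately.\<close>

lemma composite_evals_subset:
  assumes t: "composite_nodes g r \<alpha> \<kappa> n t"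
  shows "composite_evals g r \<alpha> \<kappa> n t
    \<subseteq> insert (g (x 0)) (\<Union>j\<in>{1..n}. \<Union>i\<in>{1..N j}. (\<lambda>k. g (t j i k)) ` {1..m j})"
    (is "_ \<subseteq> insert _ ?U")
proof -
  have node: "t j i 0 = equi_point (x (j - 1)) (x j) (N j) (i - 1)"
    "t j i (m j) = equi_point (x (j - 1)) (x j) (N j) i"
    if "j \<in> {1..n}" "i \<in> {1..N j}" for i j
    using t that by (auto simp: composite_nodes_def multi_filon_nodes_def filon_nodes_def)
  have U: "g (t j i k) \<in> ?U" if "j \<in> {1..n}" "i \<in> {1..N j}" "k \<in> {1..m j}" for i j k
    using that by blast
  have last: "m j \<in> {1..m j}" for j using mesh_degree_ge[of j] n by simp
  have mem: "g (t j i k) \<in> insert (g (x 0)) ?U" if j: "j \<in> {1..n}" and i: "i \<in> {1..N j}" and k: "k \<le> m j" for i j k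
  proof -
    consider "k \<ge> 1" | "k = 0" "i > 1" | "k = 0" "i = 1" "j > 1" | "k = 0" "i = 1" "j = 1"
      using i j by fastforce
    then show ?thesis
    proof cases
      case 1
      then show ?thesis using U j i k by auto
    next
      case 2
      then have "i - 1 \<in> {1..N j}" using i by auto
      then have "t j i k = t j (i - 1) (m j)" using node j i 2 by simp
      then show ?thesis using U[OF j \<open>i - 1 \<in> _\<close> last] by simp
    next
      \<comment> \<open>The first piece of a later cell starts at the last node of the last piece of
        the preceding cell, which exists as every cell has at least one piece.\<close>
      case 3
      then have j': "j - 1 \<in> {1..n}" using j by auto
      have N': "N (j - 1) \<in> {1..N (j - 1)}" "N (j - 1) \<noteq> 0"
        using mesh_count_bounds(1)[OF j'] by auto
      have "t j i k = t (j - 1) (N (j - 1)) (m (j - 1))"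
        using node(1)[OF j i] node(2)[OF j' N'(1)] 3 N'(2) by simp
      then show ?thesis using U[OF j' N'(1) last] by simp
    next
      case 4
      then show ?thesis using node(1)[OF j i] by simp
    qed
  qed
  show ?thesis
  proof
    fix y assume "y \<in> composite_evals g r \<alpha> \<kappa> n t"
    then obtain j i k where jik: "j \<in> {1..n}" "i \<in> {1..N j}" "k \<le> m j" and y: "y = g (t j i k)"
      by (fastforce simp: composite_evals_def multi_filon_evals_def filon_evals_def)
    show "y \<in> insert (g (x 0)) ?U" unfolding y using jik by (rule mem)
  qed
qed

text \<open>For a natural factor \<open>k\<close>, the ceiling of \<open>k * (1 - \<alpha>)\<close>
  is at most \<open>k\<close> times that of \<open>1 - \<alpha>\<close>; the factors
  \<open>n + 1 - j\<close> sum to a triangular number.\<close>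

lemma sum_mesh_degree_le:
  "real (\<Sum>j=1..n. m j) \<le> (2 * real n ^ 2 + of_int \<lceil>1 - \<alpha>\<rceil> * (real n ^ 2 + real n)) / 2"
proof -
  have "real (m j) \<le> real n + of_int \<lceil>1 - \<alpha>\<rceil> * (real n + 1 - real j)" if j: "j \<in> {1..n}" for j
  proof -
    have "(real n + 1 - real j) * (1 - \<alpha>) \<le> of_int (\<lceil>1 - \<alpha>\<rceil> * (int n + 1 - int j))"
      using j by (auto simp: mult.commute intro!: mult_left_mono)
    then have "\<lceil>(real n + 1 - real j) * (1 - \<alpha>)\<rceil> \<le> \<lceil>1 - \<alpha>\<rceil> * (int n + 1 - int j)"
      by (rule ceiling_le)
    \<comment> \<open>So \<open>nat\<close> in \<open>mesh_degree\<close> does not truncate.\<close>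
    moreover have "0 \<le> \<lceil>(real n + 1 - real j) * (1 - \<alpha>)\<rceil>"
      using j \<alpha> by (auto intro: order.strict_trans2[of _ 0] mult_nonneg_nonneg)
    ultimately have "int (m j) \<le> int n + \<lceil>1 - \<alpha>\<rceil> * (int n + 1 - int j)"
      by (simp add: mesh_degree_def)
    then have "real_of_int (int (m j)) \<le> real_of_int (int n + \<lceil>1 - \<alpha>\<rceil> * (int n + 1 - int j))"
      by (simp only: of_int_le_iff)
    then show ?thesis by simp
  qed
  then have "real (\<Sum>j=1..n. m j) \<le> (\<Sum>j=1..n. real n + of_int \<lceil>1 - \<alpha>\<rceil> * (real n + 1 - real j))"
    unfolding of_nat_sum by (intro sum_mono)
  also have "\<dots> = real n ^ 2 + of_int \<lceil>1 - \<alpha>\<rceil> * (\<Sum>j=1..n. real n + 1 - real j)"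
    by (simp add: sum.distrib sum_distrib_left power2_eq_square)
  also have "(\<Sum>j=1..n. real n + 1 - real j) = (real n ^ 2 + real n) / 2"
    using double_gauss_sum_from_Suc_0[of n, where 'a = real]
    by (simp add: sum_subtractf power2_eq_square algebra_simps)
  finally show ?thesis by (simp add: add_divide_distrib distrib_left)
qed

text \<open>With left ends dropped, each piece contributes at most \<open>m j\<close> points; the
  final 1 counts the left end of the whole interval.\<close>

lemma num_evaluations_le:
  assumes t: "composite_nodes g r \<alpha> \<kappa> n t"
  shows "real (num_evaluations g r \<alpha> \<kappa> n t)
    \<le> of_int \<lceil>real (r + 1) * \<mu> ^ r * \<sigma> / \<delta>\<rceil>
        * (2 * real n ^ 2 + of_int \<lceil>1 - \<alpha>\<rceil> * (real n ^ 2 + real n)) / 2 + 1"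
proof -
  let ?U = "\<Union>j\<in>{1..n}. \<Union>i\<in>{1..N j}. (\<lambda>k. g (t j i k)) ` {1..m j}"
  let ?Q = "\<lceil>real (r + 1) * \<mu> ^ r * \<sigma> / \<delta>\<rceil>"
  have inner: "card (\<Union>i\<in>{1..N j}. (\<lambda>k. g (t j i k)) ` {1..m j}) \<le> N j * m j" for j
  proof -
    have "card (\<Union>i\<in>{1..N j}. (\<lambda>k. g (t j i k)) ` {1..m j})
        \<le> (\<Sum>i\<in>{1..N j}. card ((\<lambda>k. g (t j i k)) ` {1..m j}))"
      by (rule card_UN_le) simp
    also have "\<dots> \<le> (\<Sum>i\<in>{1..N j}. m j)"
      by (intro sum_mono order.trans[OF card_image_le]) auto
    finally show ?thesis by simp
  qed
  have "num_evaluations g r \<alpha> \<kappa> n t \<le> card (insert (g (x 0)) ?U)"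
    unfolding num_evaluations_def by (intro card_mono composite_evals_subset[OF t]) auto
  also have "\<dots> \<le> card ?U + 1" by (simp add: card_insert_if)
  also have "card ?U \<le> (\<Sum>j=1..n. N j * m j)"
    by (rule order.trans[OF card_UN_le sum_mono]) (use inner in auto)
  finally have "real (num_evaluations g r \<alpha> \<kappa> n t) \<le> real ((\<Sum>j=1..n. N j * m j) + 1)"
    by (simp only: of_nat_le_iff)
  also have "\<dots> = (\<Sum>j=1..n. real (N j) * real (m j)) + 1" by simp
  also have "(\<Sum>j=1..n. real (N j) * real (m j)) \<le> (\<Sum>j=1..n. of_int ?Q * real (m j))"
  proof (intro sum_mono mult_right_mono)
    fix j assume "j \<in> {1..n}"
    then have "real_of_int (int (N j)) \<le> of_int ?Q"
      using mesh_count_bounds(3) by (simp only: of_int_le_iff)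
    then show "real (N j) \<le> of_int ?Q" by simp
  qed simp
  also have "\<dots> = of_int ?Q * real (\<Sum>j=1..n. m j)" by (simp add: sum_distrib_left)
  also have "\<dots> \<le> of_int ?Q * ((2 * real n ^ 2 + of_int \<lceil>1 - \<alpha>\<rceil> * (real n ^ 2 + real n)) / 2)"
  proof (rule mult_left_mono[OF sum_mesh_degree_le])
    have "0 \<le> real (r + 1) * \<mu> ^ r * \<sigma> / \<delta>" using mu_gt_1 sigma_pos delta_pos by simp
    then show "0 \<le> real_of_int ?Q" using order.trans[OF _ le_of_int_ceiling] by blast
  qed
  finally show ?thesis by simp
qed

end

section \<open>Assembly of the error bound and the evaluation count\<close>

theorem theorem5p12:
  fixes r :: nat and f g :: "real \<Rightarrow> real" and \<alpha> :: real
  assumes "r > 0"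
    and "C_k_on (r + 1) {0..1} g"
    and "\<forall>j\<in>{0..r}. nth_deriv_on {0..1} j g 0 = 0"
    and "\<forall>x\<in>{0..1}. nth_deriv_on {0..1} (r + 1) g x \<noteq> 0"
    and "mono_on {0..1} g"
    and "no_inflection_point g"
    and "f absolutely_integrable_on {0..1}"
    and "continuous_on {0<..1} f"
    and "\<alpha> \<in> {-1<..<1}"
    and "type_infinity_zero \<alpha> (Theta f g)"
  shows
    "(\<exists>c>0. \<forall>\<kappa>>1. \<forall>n\<ge>1. \<forall>t.
        kappa_sigma r g \<kappa> powr (1 / real n) * (kappa_sigma r g \<kappa> powr (1 / real n) - 1)
          \<le> (real n - 1) / exp 1 \<longrightarrow>
        composite_nodes g r \<alpha> \<kappa> n t \<longrightarrow>
        cmod (osc_integral f g r \<kappa> - composite_rule f g r \<alpha> \<kappa> n t)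
          \<le> c * real (r + 1) * \<bar>g 1\<bar> powr (- \<alpha>) * sigma_osc r g * delta_osc r g powr (\<alpha> - 2)
              * \<kappa> powr (- 2) * kappa_sigma r g \<kappa> powr (1 / real (r + 1)) * rho_osc r g \<kappa> n ^ n)
     \<and> (\<forall>\<kappa>>1. \<forall>n\<ge>1. \<forall>t. composite_nodes g r \<alpha> \<kappa> n t \<longrightarrow>
        real (num_evaluations g r \<alpha> \<kappa> n t)
          \<le> of_int \<lceil>real (r + 1) * kappa_sigma r g \<kappa> powr (real r / (real n * real (r + 1)))
                      * sigma_osc r g / delta_osc r g\<rceil>
              * (2 * real n ^ 2 + of_int \<lceil>1 - \<alpha>\<rceil> * (real n ^ 2 + real n)) / 2 + 1)"
proof -
  interpret filon_setting r f g \<alpha>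
    by unfold_locales (fact assms)+
  \<comment> \<open>Chosen so that \<open>A\<close> becomes \<open>c\<close> times the factors of
    the claim free of \<kappa> and \<open>n\<close>: it is divided by
    \<open>(r + 1) * \<sigma>\<close>, and the factor \<open>\<delta>\<close> turns
    \<open>\<delta> powr (\<alpha> - 2)\<close> into
    \<open>\<delta> powr (\<alpha> - 1)\<close>.\<close>
  define c where "c = 12 * (real (r + 1) * \<sigma> / \<delta> + 1) * C * \<delta> / (real (r + 1) * \<sigma>)"
  have c: "c > 0" using C_spec(1) sigma_pos delta_pos by (simp add: c_def add_pos_pos)
  have "cmod (osc_integral f g r \<kappa> - composite_rule f g r \<alpha> \<kappa> n t)
      \<le> c * real (r + 1) * \<bar>g 1\<bar> powr (- \<alpha>) * \<sigma> * \<delta> powr (\<alpha> - 2)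
          * \<kappa> powr (- 2) * kappa_sigma r g \<kappa> powr (1 / real (r + 1)) * rho_osc r g \<kappa> n ^ n"
    if "\<kappa> > 1" "n \<ge> 1"
      and cond: "kappa_sigma r g \<kappa> powr (1 / real n) * (kappa_sigma r g \<kappa> powr (1 / real n) - 1)
          \<le> (real n - 1) / exp 1"
      and t: "composite_nodes g r \<alpha> \<kappa> n t" for \<kappa> n t
  proof -
    interpret filon_mesh r f g \<alpha> \<kappa> n
      by unfold_locales (fact that)+
    have "\<delta> powr (\<alpha> - 1) = \<delta> * \<delta> powr (\<alpha> - 2)"
      using delta_pos powr_add[of \<delta> 1 "\<alpha> - 2"] by simp
    then have A: "A = c * real (r + 1) * g 1 powr (- \<alpha>) * \<sigma> * \<delta> powr (\<alpha> - 2)"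
      using sigma_pos by (simp add: A_def c_def del: of_nat_add)
    have "\<kappa> powr (- 2) = 1 / \<kappa>\<^sup>2"
      using \<kappa> powr_realpow[of \<kappa> 2] by (simp add: powr_minus_divide)
    then show ?thesis
      using composite_rule_error_rate[OF t cond[folded \<nu>_def]] g1_pos
      by (simp add: A mu_minus_1_power mult.assoc)
  qed
  moreover have "real (num_evaluations g r \<alpha> \<kappa> n t)
      \<le> of_int \<lceil>real (r + 1) * kappa_sigma r g \<kappa> powr (real r / (real n * real (r + 1))) * \<sigma> / \<delta>\<rceil>
          * (2 * real n ^ 2 + of_int \<lceil>1 - \<alpha>\<rceil> * (real n ^ 2 + real n)) / 2 + 1"
    if "\<kappa> > 1" "n \<ge> 1" "composite_nodes g r \<alpha> \<kappa> n t" for \<kappa> n t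
  proof -
    interpret filon_mesh r f g \<alpha> \<kappa> n
      by unfold_locales (fact that)+
    show ?thesis using num_evaluations_le[OF that(3)] unfolding mu_power_r .
  qed
  ultimately show ?thesis using c by blast
qed

end
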